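(* Let $X$ be a finite connected graph whose Euler characteristic $\chi(X)$ does not vanish, and let $\alpha\colon \mathbf{E}_X\to\mathbb{Z}$ be a voltage assignment such that for every $n\ge 1$ the finite graph $X_n := X(\mathbb{Z}/n\mathbb{Z},\alpha_n)$ is connected, where $\alpha_n$ is the composition of $\alpha$ with the projection $\mathbb{Z}\to\mathbb{Z}/n\mathbb{Z}$. Let $\mathcal{I}_\alpha\in\mathbb{Z}[t^{\pm1}]$ be the Ihara polynomial associated to $\alpha$, and set $J_\alpha(t) := t^b(t-1)^{-e}\mathcal{I}_\alpha(t)$, where $b := -\mathrm{ord}_{t=0}(\mathcal{I}_\alpha)$ and $e := \mathrm{ord}_{t=1}(\mathcal{I}_\alpha)$. Fix a rational prime $p$ and let $\mu_p(X,\alpha) := -m_p(J_\alpha)/\log(p)$, where $m_p(J_\alpha)$ is the logarithmic $p$-adic Mahler measure of $J_\alpha$. Then there exist two functions $\mathbb{N}\to\mathbb{Z}_{\ge 0}$, $n\mapsto\lambda_{p,n}(X,\alpha)$, and $\mathbb{N}\to\mathbb{Z}$, $n\mapsto\nu_{p,n}(X,\alpha)$, whose images are finite, and an integer $c_p(X,\alpha)$, such that $$\mathrm{ord}_p(\kappa(X_n)) = \mu_p(X,\alpha)\cdot n+\lambda_{p,n}(X,\alpha)\cdot\mathrm{ord}_p(n)+\nu_{p,n}(X,\alpha)+c_p(X,\alpha)$$ for all $n\in\mathbb{N}$.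
   Context: $\mathbb{N}=\{1,2,\dots\}$. $\mathrm{ord}_p$ and $|\cdot|_p$ are the $p$-adic valuation and absolute value on $\mathbb{C}_p$ (completion of an algebraic closure of $\mathbb{Q}_p$), with $\mathrm{ord}_p(p)=1$ and $|x|_p=p^{-\mathrm{ord}_p(x)}$. Graphs are in the sense of Serre: a graph $X$ consists of a set $V_X$ of vertices, a set $\mathbf{E}_X$ of directed edges, origin and terminus maps $o,t\colon\mathbf{E}_X\to V_X$, and an inversion $e\mapsto\bar e$ on $\mathbf{E}_X$ with $o(\bar e)=t(e)$, $t(\bar e)=o(e)$ and $\bar{\bar e}=e\ne\bar e$. Loops and multiple edges are allowed. $X$ is finite if $V_X$ and $\mathbf{E}_X$ are finite, and connected if any two vertices are joined by a path of directed edges. $\chi(X)=|V_X|-|\mathbf{E}_X|/2$, and $\kappa(X)$ is the number of spanning trees of $X$. A voltage assignment with values in a group $G$ is a function $\alpha\colon\mathbf{E}_X\to G$ with $\alpha(\bar e)=\alpha(e)^{-1}$ for all $e$. The graph $X(G,\alpha)$ has vertex set $V_X\times G$, edge set $\mathbf{E}_X\times G$, and $o(e,\sigma)=(o(e),\sigma)$, $t(e,\sigma)=(t(e),\sigma\cdot\alpha(e))$, $\overline{(e,\sigma)}=(\bar e,\sigma\cdot\alpha(e))$. Ihara polynomial of $\alpha\colon\mathbf{E}_X\to\mathbb{Z}$: order $V_X=\{v_1,\dots,v_g\}$, let $D_X$ be the diagonal matrix with entries $\#\{e\in\mathbf{E}_X: o(e)=v_i\}$, and let $A_\alpha(t)$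 be the $g\times g$ matrix with $(i,j)$ entry $\sum_{e:\,o(e)=v_i,\,t(e)=v_j}t^{\alpha(e)}$; then $\mathcal{I}_\alpha(t)=\det(D_X-A_\alpha(t))\in\mathbb{Z}[t^{\pm1}]$. $\mathrm{ord}_{t=a}$ denotes the order of vanishing at $t=a$. For a nonzero polynomial $g(t)=b_d\prod_{i=1}^d(t-\beta_i)\in\mathbb{C}_p[t]$, the $p$-adic Mahler measure is $M_p(g)=|b_d|_p\prod_{i=1}^d\max\{1,|\beta_i|_p\}$, and $m_p(g)=\log M_p(g)$. *)

theory Defs
  imports
    "HOL-Library.Poly_Mapping"
    "HOL-Computational_Algebra.Computational_Algebra"
    "HOL-Algebra.Elementary_Groups"
    "HOL-Analysis.Abstract_Metric_Spaces"
    "Graph_Theory.Graph_Theory"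
    "Jordan_Normal_Form.Determinant"
begin

section \<open>Graphs in the sense of Serre\<close>

text \<open>
  A Serre graph is a \<open>bidirected_digraph X bar\<close>: \<open>tail X\<close> and \<open>head X\<close> are the origin and
  terminus maps on \<open>arcs X\<close>, and \<open>bar\<close> is the inversion, extended by the identity outside
  \<open>arcs X\<close>. "Any two vertices are joined by a path of directed edges" is
  \<open>strongly_connected X\<close>.
\<close>

definition euler_char :: "('v, 'e) pre_digraph \<Rightarrow> real" where
  "euler_char X = real (card (verts X)) - real (card (arcs X)) / 2"

text \<open>
  The library's cycles are closed directed walks without repeated vertices, so they include the
  walk that runs along an edge and straight back. A circuit of a Serre graph is a cycle in which no
  edge occurs together with its inverse; loops and pairs of parallel edges do give circuits.
\<close>

definition serre_circuit :: "('v, 'e) pre_digraph \<Rightarrow> ('e \<Rightarrow> 'e) \<Rightarrow> 'e list \<Rightarrow> bool" where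
  "serre_circuit X bar q \<longleftrightarrow> pre_digraph.cycle X q \<and> (\<forall>e \<in> set q. bar e \<notin> set q)"

definition serre_tree :: "('v, 'e) pre_digraph \<Rightarrow> ('e \<Rightarrow> 'e) \<Rightarrow> bool" where
  "serre_tree X bar \<longleftrightarrow> strongly_connected X \<and> (\<nexists>q. serre_circuit X bar q)"

text \<open>A spanning tree is determined by its set of edges, which is closed under inversion.\<close>

definition spanning_trees :: "('v, 'e) pre_digraph \<Rightarrow> ('e \<Rightarrow> 'e) \<Rightarrow> 'e set set" where
  "spanning_trees X bar = {T. T \<subseteq> arcs X \<and> bar ` T \<subseteq> T \<and> serre_tree (X\<lparr>arcs := T\<rparr>) bar}"

definition kappa :: "('v, 'e) pre_digraph \<Rightarrow> ('e \<Rightarrow> 'e) \<Rightarrow> nat" where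
  "kappa X bar = card (spanning_trees X bar)"


section \<open>Voltage assignments and derived graphs\<close>

definition voltage_assignment ::
    "('v, 'e) pre_digraph \<Rightarrow> ('e \<Rightarrow> 'e) \<Rightarrow> ('g, 'm) monoid_scheme \<Rightarrow> ('e \<Rightarrow> 'g) \<Rightarrow> bool" where
  "voltage_assignment X bar G \<alpha> \<longleftrightarrow>
     (\<forall>e \<in> arcs X. \<alpha> e \<in> carrier G \<and> \<alpha> (bar e) = inv\<^bsub>G\<^esub> (\<alpha> e))"

definition derived_graph ::
    "('v, 'e) pre_digraph \<Rightarrow> ('g, 'm) monoid_scheme \<Rightarrow> ('e \<Rightarrow> 'g) \<Rightarrow> ('v \<times> 'g, 'e \<times> 'g) pre_digraph"
  where
  "derived_graph X G \<alpha> =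
     \<lparr>verts = verts X \<times> carrier G,
      arcs = arcs X \<times> carrier G,
      tail = (\<lambda>(e, \<sigma>). (tail X e, \<sigma>)),
      head = (\<lambda>(e, \<sigma>). (head X e, \<sigma> \<otimes>\<^bsub>G\<^esub> \<alpha> e))\<rparr>"

definition derived_bar ::
    "('v, 'e) pre_digraph \<Rightarrow> ('e \<Rightarrow> 'e) \<Rightarrow> ('g, 'm) monoid_scheme \<Rightarrow> ('e \<Rightarrow> 'g) \<Rightarrow> 'e \<times> 'g \<Rightarrow> 'e \<times> 'g"
  where
  "derived_bar X bar G \<alpha> =
     (\<lambda>(e, \<sigma>). if e \<in> arcs X \<and> \<sigma> \<in> carrier G then (bar e, \<sigma> \<otimes>\<^bsub>G\<^esub> \<alpha> e) else (e, \<sigma>))"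

lemma bidirected_derived_graph:
  fixes X (structure)
  assumes "bidirected_digraph X bar" "group G" "voltage_assignment X bar G \<alpha>"
  shows "bidirected_digraph (derived_graph X G \<alpha>) (derived_bar X bar G \<alpha>)"
proof -
  interpret bidirected_digraph X bar by fact
  interpret G: group G by fact
  have V: "\<alpha> e \<in> carrier G" "\<alpha> (bar e) = inv\<^bsub>G\<^esub> (\<alpha> e)" if "e \<in> arcs X" for e
    using assms(3) that by (auto simp: voltage_assignment_def)
  show ?thesis
    by unfold_locales
       (auto simp: derived_graph_def derived_bar_def V arev_neq G.m_assoc split: if_splits)
qed

definition voltage_mod :: "('e \<Rightarrow> int) \<Rightarrow> nat \<Rightarrow> 'e \<Rightarrow> int" where
  "voltage_mod \<alpha> n = (\<lambda>e. \<alpha> e mod int n)"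

definition cyclic_cover :: "('v, 'e) pre_digraph \<Rightarrow> ('e \<Rightarrow> int) \<Rightarrow> nat \<Rightarrow> ('v \<times> int, 'e \<times> int) pre_digraph"
  where "cyclic_cover X \<alpha> n = derived_graph X (integer_mod_group n) (voltage_mod \<alpha> n)"

definition cyclic_cover_bar ::
    "('v, 'e) pre_digraph \<Rightarrow> ('e \<Rightarrow> 'e) \<Rightarrow> ('e \<Rightarrow> int) \<Rightarrow> nat \<Rightarrow> 'e \<times> int \<Rightarrow> 'e \<times> int"
  where "cyclic_cover_bar X bar \<alpha> n = derived_bar X bar (integer_mod_group n) (voltage_mod \<alpha> n)"


section \<open>The Ihara polynomial\<close>

text \<open>
  The ring of integral Laurent polynomials is the group ring of the integers, i.e. the finitely
  supported functions from exponents to coefficients with the convolution product; the monomial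
  with coefficient \<open>c\<close> and exponent \<open>k\<close> is \<open>Poly_Mapping.single k c\<close>.
\<close>

type_synonym laurent = "int \<Rightarrow>\<^sub>0 int"

text \<open>The list \<open>vs\<close> is an ordering of the vertices.\<close>

definition ihara_matrix :: "('v, 'e) pre_digraph \<Rightarrow> ('e \<Rightarrow> int) \<Rightarrow> 'v list \<Rightarrow> laurent mat" where
  "ihara_matrix X \<alpha> vs =
     mat (length vs) (length vs) (\<lambda>(i, j).
       if i = j then of_nat (card {e \<in> arcs X. tail X e = vs ! i}) else 0) -
     mat (length vs) (length vs) (\<lambda>(i, j).
       \<Sum>e \<in> {e \<in> arcs X. tail X e = vs ! i \<and> head X e = vs ! j}. Poly_Mapping.single (\<alpha> e) 1)"

definition ihara_poly :: "('v, 'e) pre_digraph \<Rightarrow> ('e \<Rightarrow> int) \<Rightarrow> 'v list \<Rightarrow> laurent" where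
  "ihara_poly X \<alpha> vs = Determinant.det (ihara_matrix X \<alpha> vs)"

text \<open>The order of vanishing at \<open>t = 0\<close> of a nonzero Laurent polynomial (possibly negative).\<close>

definition laurent_ord0 :: "laurent \<Rightarrow> int" where
  "laurent_ord0 f = Min (Poly_Mapping.keys f)"

text \<open>
  The polynomial obtained from \<open>f\<close> by multiplying with \<open>t\<close> to the power \<open>- laurent_ord0 f\<close>. As
  \<open>t\<close> is invertible at \<open>t = 1\<close>, its order of vanishing there is that of \<open>f\<close>.
\<close>

definition laurent_shift :: "laurent \<Rightarrow> int poly" where
  "laurent_shift f =
     (\<Sum>k \<in> Poly_Mapping.keys f. monom (Poly_Mapping.lookup f k) (nat (k - laurent_ord0 f)))"

definition laurent_ord1 :: "laurent \<Rightarrow> nat" where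
  "laurent_ord1 f = Polynomial.order 1 (laurent_shift f)"

text \<open>The division by the power of \<open>t - 1\<close> is exact.\<close>

definition J_poly :: "('v, 'e) pre_digraph \<Rightarrow> ('e \<Rightarrow> int) \<Rightarrow> 'v list \<Rightarrow> int poly" where
  "J_poly X \<alpha> vs =
     laurent_shift (ihara_poly X \<alpha> vs) div [:- 1, 1:] ^ laurent_ord1 (ihara_poly X \<alpha> vs)"


section \<open>The field of \<open>p\<close>-adic complex numbers\<close>

locale nonarch_abs =
  fixes v :: "'k::field_char_0 \<Rightarrow> real"
  assumes v_nonneg: "0 \<le> v x"
    and v_eq_0_iff: "v x = 0 \<longleftrightarrow> x = 0"
    and v_mult: "v (x * y) = v x * v y"
    and v_ultrametric: "v (x + y) \<le> max (v x) (v y)"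
begin

lemma v_minus: "v (- x) = v x"
proof -
  have "v 1 = 1"
    using v_mult[of 1 1] v_eq_0_iff[of 1] by simp
  hence "v (- 1) = 1"
    using v_mult[of "- 1" "- 1"] v_nonneg[of "- 1"] by (simp add: power2_eq_1_iff flip: power2_eq_square)
  thus ?thesis
    using v_mult[of "- 1" x] by simp
qed

sublocale metric: Metric_space UNIV "\<lambda>x y. v (x - y)"
proof
  show "v (x - y) = v (y - x)" for x y
    using v_minus[of "x - y"] by simp
  show "v (x - z) \<le> v (x - y) + v (y - z)" for x y z
    using v_ultrametric[of "x - y" "y - z"] v_nonneg[of "x - y"] v_nonneg[of "y - z"] by simp
qed (simp_all add: v_nonneg v_eq_0_iff)

end

definition algebraic_elements :: "'k::field set \<Rightarrow> 'k set" where
  "algebraic_elements F = {x. \<exists>f. f \<noteq> 0 \<and> (\<forall>i. coeff f i \<in> F) \<and> poly f x = 0}"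

definition alg_closed_subfield :: "'k::field set \<Rightarrow> bool" where
  "alg_closed_subfield F \<longleftrightarrow>
     (\<forall>f. (\<forall>i. coeff f i \<in> F) \<and> degree f > 0 \<longrightarrow> (\<exists>x \<in> F. poly f x = 0))"

text \<open>
  A field with absolute value is (a copy of) the completion of an algebraic closure of the
  \<open>p\<close>-adic numbers iff it is complete, and contains the \<open>p\<close>-adic numbers, an
  algebraic closure of these, and the latter is dense. The \<open>p\<close>-adic numbers are the completion of
  the rationals for the \<open>p\<close>-adic absolute value; inside a complete field this is the closure of
  the rationals. Multiplicativity, the ultrametric inequality and \<open>abs_p\<close> force \<open>v\<close> to be the
  \<open>p\<close>-adic absolute value on the rationals. These conditions determine the field together with
  \<open>v\<close> up to isometric isomorphism.
\<close>

locale padic_complex_field = nonarch_abs v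
  for p :: nat and v :: "'k::field_char_0 \<Rightarrow> real" +
  assumes prime_p: "prime p"
    and abs_p: "v (of_nat p) = 1 / real p"
    and complete: "metric.mcomplete"
    and alg_closure_closed:
      "alg_closed_subfield (algebraic_elements (metric.mtopology closure_of \<rat>))"
    and alg_closure_dense:
      "metric.mtopology closure_of (algebraic_elements (metric.mtopology closure_of \<rat>)) = UNIV"


section \<open>The \<open>p\<close>-adic Mahler measure\<close>

text \<open>\<open>v\<close> is the absolute value; \<open>proots g\<close> is the multiset of roots of \<open>g\<close>.\<close>

definition padic_mahler :: "('k::field_char_0 \<Rightarrow> real) \<Rightarrow> 'k poly \<Rightarrow> real" where
  "padic_mahler v g = v (lead_coeff g) * (\<Prod>\<beta> \<in># proots g. max 1 (v \<beta>))"

definition log_padic_mahler :: "('k::field_char_0 \<Rightarrow> real) \<Rightarrow> 'k poly \<Rightarrow> real" where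
  "log_padic_mahler v g = ln (padic_mahler v g)"

definition mu_invariant ::
    "nat \<Rightarrow> ('k::field_char_0 \<Rightarrow> real) \<Rightarrow> ('v, 'e) pre_digraph \<Rightarrow> ('e \<Rightarrow> int) \<Rightarrow> 'v list \<Rightarrow> real" where
  "mu_invariant p v X \<alpha> vs =
     - log_padic_mahler v (map_poly of_int (J_poly X \<alpha> vs)) / ln (real p)"

end

theory Submission
  imports Defs
begin

text \<open>
  Expanding the determinant of a weighted Laplacian over all choices of an outgoing edge (or of a
  weighted sink) at every vertex leaves only the acyclic choices, so its linear coefficient counts
  spanning trees. For the cover \<open>X\<^sub>n\<close> the Laplacian is block circulant; conjugating by the character
  table of the cyclic group and comparing linear coefficients gives
  \<open>n \<kappa>(X\<^sub>n) = \<kappa>(X\<^sub>1) \<Prod> I(\<zeta>)\<close>, the product over the \<open>n\<close>-th roots of unity \<open>\<zeta> \<noteq> 1\<close>, which may be taken in the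
  \<open>p\<close>-adic field itself. With \<open>I(t) = t^o (t - 1)^e J(t)\<close> this turns into
  \<open>|n \<kappa>(X\<^sub>n)| = const \<cdot> |n|^e |b|^n \<Prod> |\<beta>^n - 1|\<close>, the product over the roots \<open>\<beta>\<close> of \<open>J\<close>, where
  \<open>b\<close> is the leading coefficient. A root with
  \<open>|\<beta>| \<noteq> 1\<close> contributes \<open>max 1 |\<beta>|^n\<close>. A root of absolute value 1 is not a root of unity, as all
  covers are connected; if \<open>m\<close> is the order of its reduction, it contributes 1 unless \<open>m\<close> divides \<open>n\<close>,
  and then \<open>|n|\<close> up to finitely many factors. Finally the Mahler measure is the Gauss norm, hence an
  integral power of \<open>p\<close>, so that the bounded remainder is an integer.
\<close>

section \<open>Arborescences and spanning trees\<close>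

text \<open>The choice of sinks shapes the first half. Singling out one root would count the
  spanning trees of a cover but break its cyclic symmetry. Hence a variable t is added on the
  diagonal along one whole fibre: the matrix stays block circulant, the constant coefficient of its
  determinant is 0, and the linear one counts every spanning tree once for each of the n possible
  roots. This is the factor n beside the number of trees. The block at z = 1 already has constant
  coefficient 0, so the linear coefficient of the product of all blocks is again a product.

  In the second half the axioms for the field give one root at a time, and only for coefficients
  algebraic over the p-adic numbers. To go on after dividing by a linear factor, the coefficients
  must stay in a set known to be closed under sums and products. The splitting is therefore carried
  out among the numbers algebraic over the rationals, where closure follows from a dimension count.

  Since the Mahler measure is a power of p, the difference of both sides is an integer by
  construction. It is taken as nu, with c = 0, and only the finiteness of its range has to be
  shown.\<close>

text \<open>For a map that stays inside \<open>V\<close>, the rank is the number of steps until it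
  stops. Its existence excludes cycles without mentioning them, and it serves as induction measure
  and as a potential that drops along every step.\<close>

definition ranked :: "('v \<Rightarrow> 'v option) \<Rightarrow> 'v set \<Rightarrow> bool" where
  "ranked h V \<longleftrightarrow>
     (\<exists>d :: 'v \<Rightarrow> nat. \<forall>v \<in> V. d v = (case h v of None \<Rightarrow> 0 | Some w \<Rightarrow> Suc (d w)))"

text \<open>The value is an arc and not merely a neighbour, because parallel arcs give different
  trees. \<open>None\<close> marks the root.\<close>

definition arborescences :: "('v, 'e) pre_digraph \<Rightarrow> 'v \<Rightarrow> ('v \<Rightarrow> 'e option) set" where
  "arborescences G r =
     {\<phi> \<in> PiE (verts G) (\<lambda>v. if v = r then {None} else Some ` out_arcs G v).
        ranked (\<lambda>v. map_option (head G) (\<phi> v)) (verts G)}"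

definition tree_arcs :: "('v, 'e) pre_digraph \<Rightarrow> ('e \<Rightarrow> 'e) \<Rightarrow> ('v \<Rightarrow> 'e option) \<Rightarrow> 'e set" where
  "tree_arcs G bar \<phi> = {e. \<exists>v \<in> verts G. \<phi> v = Some e} \<union> bar ` {e. \<exists>v \<in> verts G. \<phi> v = Some e}"

lemma (in pre_digraph) cas_predecessor:
  assumes "cas u q w" "e \<in> set q"
  shows "tail G e = u \<or> (\<exists>e' \<in> set q. head G e' = tail G e)"
  using assms by (induction q arbitrary: u) auto

lemma (in pre_digraph) cas_last:
  assumes "cas u q w" "q \<noteq> []"
  shows "\<exists>e \<in> set q. head G e = w"
  using assms
proof (induction q arbitrary: u)
  case (Cons a q)
  then show ?case by (cases q) auto
qed simp

lemma (in pre_digraph) closed_cas_predecessor: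
  assumes "cas u q u" "e \<in> set q"
  shows "\<exists>e' \<in> set q. head G e' = tail G e"
  using cas_predecessor[OF assms] cas_last[OF assms(1)] assms(2) by fastforce

lemma (in pre_digraph) cas_successor:
  assumes "cas u q w" "e \<in> set q"
  shows "head G e = w \<or> (\<exists>e' \<in> set q. tail G e' = head G e)"
  using assms
proof (induction q arbitrary: u)
  case (Cons a q)
  then show ?case by (cases q) auto
qed simp

lemma (in pre_digraph) closed_cas_successor:
  assumes "cas u q u" "e \<in> set q"
  shows "\<exists>e' \<in> set q. tail G e' = head G e"
  using cas_successor[OF assms] assms by (cases q) auto

context bidirected_digraph
begin

lemma arborescenceE:
  assumes "\<phi> \<in> arborescences G r"
  obtains d :: "'a \<Rightarrow> nat" where
    "\<And>v. v \<in> verts G \<Longrightarrow> v \<noteq> r \<Longrightarrow>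
       \<exists>e \<in> arcs G. \<phi> v = Some e \<and> tail G e = v \<and> d v = Suc (d (head G e))"
proof -
  from assms obtain d :: "'a \<Rightarrow> nat" where
    d: "\<forall>v\<in>verts G. d v = (case map_option (head G) (\<phi> v) of None \<Rightarrow> 0 | Some w \<Rightarrow> Suc (d w))"
    unfolding arborescences_def ranked_def by blast
  show thesis
  proof (rule that)
    fix v assume v: "v \<in> verts G" "v \<noteq> r"
    from assms v have "\<phi> v \<in> Some ` out_arcs G v"
      unfolding arborescences_def by (auto dest!: PiE_mem[where x = v])
    then obtain e where "\<phi> v = Some e" "e \<in> arcs G" "tail G e = v" by auto
    with d v show "\<exists>e \<in> arcs G. \<phi> v = Some e \<and> tail G e = v \<and> d v = Suc (d (head G e))"
      by auto
  qed
qed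

lemma arborescence_root: "\<phi> \<in> arborescences G r \<Longrightarrow> r \<in> verts G \<Longrightarrow> \<phi> r = None"
  unfolding arborescences_def by (auto dest!: PiE_mem[where x = r])

lemma wf_sub: "T \<subseteq> arcs G \<Longrightarrow> wf_digraph (G\<lparr>arcs := T\<rparr>)"
  by unfold_locales auto

lemma tree_arcs_subset:
  assumes "\<phi> \<in> arborescences G r" "r \<in> verts G"
  shows "tree_arcs G arev \<phi> \<subseteq> arcs G"
proof -
  have "e \<in> arcs G" if "v \<in> verts G" "\<phi> v = Some e" for e v
    using arborescenceE[OF assms(1)] arborescence_root[OF assms] that
    by (metis option.distinct(1) option.inject)
  thus ?thesis by (auto simp: tree_arcs_def)
qed

lemma tree_arcs_arev: "e \<in> tree_arcs G arev \<phi> \<Longrightarrow> arev e \<in> tree_arcs G arev \<phi>"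
  by (auto simp: tree_arcs_def)

lemma tree_arcs_connected:
  assumes phi: "\<phi> \<in> arborescences G r" and r: "r \<in> verts G"
  shows "strongly_connected (G\<lparr>arcs := tree_arcs G arev \<phi>\<rparr>)"
proof -
  let ?T = "tree_arcs G arev \<phi>" and ?H = "G\<lparr>arcs := tree_arcs G arev \<phi>\<rparr>"
  interpret H: wf_digraph ?H using wf_sub tree_arcs_subset[OF assms] .
  have adj: "tail G e \<rightarrow>\<^bsub>?H\<^esub> head G e" if "e \<in> ?T" for e
    using that H.in_arcs_imp_in_arcs_ends[of e] by simp
  obtain d :: "'a \<Rightarrow> nat" where d: "\<And>v. v \<in> verts G \<Longrightarrow> v \<noteq> r \<Longrightarrow>
       \<exists>e \<in> arcs G. \<phi> v = Some e \<and> tail G e = v \<and> d v = Suc (d (head G e))"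
    using arborescenceE[OF phi] by blast
  have "v \<rightarrow>\<^sup>*\<^bsub>?H\<^esub> r \<and> r \<rightarrow>\<^sup>*\<^bsub>?H\<^esub> v" if "v \<in> verts G" for v
    using that
  proof (induction "d v" arbitrary: v rule: less_induct)
    case less
    show ?case
    proof (cases "v = r")
      case True
      thus ?thesis using r H.reachable_refl by auto
    next
      case False
      then obtain e where e: "e \<in> arcs G" "\<phi> v = Some e" "tail G e = v" "d v = Suc (d (head G e))"
        using d less by blast
      have T: "e \<in> ?T" "arev e \<in> ?T" using e less by (auto simp: tree_arcs_def)
      have "head G e \<rightarrow>\<^sup>*\<^bsub>?H\<^esub> r \<and> r \<rightarrow>\<^sup>*\<^bsub>?H\<^esub> head G e" using less e by simp
      moreover have "v \<rightarrow>\<^bsub>?H\<^esub> head G e" "head G e \<rightarrow>\<^bsub>?H\<^esub> v"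
        using adj[OF T(1)] adj[OF T(2)] e by auto
      ultimately show ?thesis
        using H.adj_reachable_trans H.reachable_trans H.reachable_adjI by blast
    qed
  qed
  thus ?thesis using r H.reachable_trans by (intro strongly_connectedI) (auto, blast)
qed

text \<open>Along a tree arc the rank changes by one, and the arc is, up to inversion, the one
  chosen at its higher end. At a vertex of maximal rank on a circuit, the arriving and the leaving
  arc are therefore the same arc up to inversion, which a circuit forbids.\<close>

lemma tree_arcs_no_circuit:
  assumes phi: "\<phi> \<in> arborescences G r" and r: "r \<in> verts G"
  shows "\<not> serre_circuit (G\<lparr>arcs := tree_arcs G arev \<phi>\<rparr>) arev q"
proof
  let ?T = "tree_arcs G arev \<phi>" and ?H = "G\<lparr>arcs := tree_arcs G arev \<phi>\<rparr>"
  assume "serre_circuit ?H arev q"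
  then obtain u where q: "pre_digraph.awalk ?H u q u" "q \<noteq> []"
    and no_rev: "\<And>e. e \<in> set q \<Longrightarrow> arev e \<notin> set q"
    by (auto simp: serre_circuit_def pre_digraph.cycle_def)
  have qT: "set q \<subseteq> ?T" and cas: "pre_digraph.cas ?H u q u"
    using q by (auto simp: pre_digraph.awalk_def)
  obtain d :: "'a \<Rightarrow> nat" where d: "\<And>v. v \<in> verts G \<Longrightarrow> v \<noteq> r \<Longrightarrow>
       \<exists>e \<in> arcs G. \<phi> v = Some e \<and> tail G e = v \<and> d v = Suc (d (head G e))"
    using arborescenceE[OF phi] by blast
  have dT: "\<phi> (tail G e) = Some e \<and> d (tail G e) = Suc (d (head G e)) \<or>
            \<phi> (head G e) = Some (arev e) \<and> d (head G e) = Suc (d (tail G e))" if "e \<in> ?T" for e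
  proof -
    have *: "tail G e = v \<and> d (tail G e) = Suc (d (head G e)) \<and> e \<in> arcs G"
      if "v \<in> verts G" "\<phi> v = Some e" for v e
      using d[OF that(1)] that arborescence_root[OF assms] by (cases "v = r") auto
    from that consider v where "v \<in> verts G" "\<phi> v = Some e" |
        v e' where "v \<in> verts G" "\<phi> v = Some e'" "e = arev e'"
      by (auto simp: tree_arcs_def)
    thus ?thesis by cases (use * in force)+
  qed
  define m where "m = Max (d ` tail G ` set q)"
  have "m \<in> d ` tail G ` set q" unfolding m_def using q(2) by (intro Max_in) auto
  then obtain e where e: "e \<in> set q" "d (tail G e) = m" by auto
  have m_max: "d (tail G e') \<le> m" if "e' \<in> set q" for e'
    unfolding m_def using that by (intro Max_ge) auto
  obtain e' where e': "e' \<in> set q" "head G e' = tail G e"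
    using pre_digraph.closed_cas_predecessor[OF cas e(1)] by auto
  \<comment> \<open>The head of \<open>e\<close> is the tail of the next arc, so the maximum over
    tails bounds its rank as well.\<close>
  have "d (head G e) \<le> m"
  proof (rule ccontr)
    assume "\<not> d (head G e) \<le> m"
    with e have "\<phi> (head G e) = Some (arev e)" "d (head G e) = Suc m"
      using dT[of e] qT by auto
    have "\<exists>f \<in> set q. tail G f = head G e"
      using pre_digraph.closed_cas_successor[OF cas e(1)] by auto
    then show False using m_max \<open>d (head G e) = Suc m\<close> by (metis not_less_eq_eq order_refl)
  qed
  with dT[of e] e qT have 1: "\<phi> (tail G e) = Some e" by auto
  have "\<phi> (head G e') = Some (arev e')"
    using dT[of e'] m_max[OF e'(1)] e' e qT by auto
  with 1 e' have "e = arev e'" by simp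
  with no_rev e e' show False by blast
qed

text \<open>Induction on the rank for \<open>\<psi>\<close>. The arc that \<open>\<psi>\<close>
  chooses at \<open>v\<close> lies in the tree of \<open>\<phi>\<close>. If \<open>\<phi>\<close>
  used it in the opposite direction, it would choose its inverse at the next vertex, where both
  choices already agree, and then the ranks of the two vertices would each exceed the other.\<close>

lemma tree_arcs_inj:
  assumes phi: "\<phi> \<in> arborescences G r" and psi: "\<psi> \<in> arborescences G r" and r: "r \<in> verts G"
    and eq: "tree_arcs G arev \<phi> = tree_arcs G arev \<psi>"
  shows "\<phi> = \<psi>"
proof -
  obtain d :: "'a \<Rightarrow> nat" where d: "\<And>v. v \<in> verts G \<Longrightarrow> v \<noteq> r \<Longrightarrow>
       \<exists>e \<in> arcs G. \<psi> v = Some e \<and> tail G e = v \<and> d v = Suc (d (head G e))"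
    using arborescenceE[OF psi] by blast
  obtain c :: "'a \<Rightarrow> nat" where c: "\<And>v. v \<in> verts G \<Longrightarrow> v \<noteq> r \<Longrightarrow>
       \<exists>e \<in> arcs G. \<phi> v = Some e \<and> tail G e = v \<and> c v = Suc (c (head G e))"
    using arborescenceE[OF phi] by blast
  have "\<phi> v = \<psi> v" if "v \<in> verts G" for v
    using that
  proof (induction "d v" arbitrary: v rule: less_induct)
    case less
    show ?case
    proof (cases "v = r")
      case True
      thus ?thesis using arborescence_root[OF phi r] arborescence_root[OF psi r] by simp
    next
      case False
      then obtain e where e: "e \<in> arcs G" "\<psi> v = Some e" "tail G e = v" "d v = Suc (d (head G e))"
        using d less by blast
      define w where "w = head G e"
      have w: "w \<in> verts G" "\<phi> w = \<psi> w" using less e by (auto simp: w_def)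
      have "e \<in> tree_arcs G arev \<phi>" unfolding eq using e less by (auto simp: tree_arcs_def)
      then consider x where "x \<in> verts G" "\<phi> x = Some e" |
        x e' where "x \<in> verts G" "\<phi> x = Some e'" "e = arev e'"
        by (auto simp: tree_arcs_def)
      thus ?thesis
      proof cases
        case (1 x)
        hence "x = v" using c[of x] arborescence_root[OF phi r] e by (cases "x = r") auto
        thus ?thesis using 1 e by simp
      next
        case (2 x e')
        hence "tail G e' = x" "e' \<in> arcs G"
          using c[of x] arborescence_root[OF phi r] by (cases "x = r"; auto)+
        hence "x = w" "head G e' = v" using 2 e by (auto simp: w_def)
        hence "\<psi> w = Some e'" using 2 w by simp
        hence "d w = Suc (d v)" using d[OF w(1)] arborescence_root[OF psi r] \<open>head G e' = v\<close>
          by (cases "w = r") auto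
        thus ?thesis using e by (simp add: w_def)
      qed
    qed
  qed
  moreover have "\<phi> v = \<psi> v" if "v \<notin> verts G" for v
    using phi psi that by (auto simp: arborescences_def PiE_def extensional_def)
  ultimately show ?thesis by blast
qed

text \<open>Every vertex points to a neighbour on a shortest path to the root.\<close>

lemma connected_imp_arborescence:
  assumes T: "T \<subseteq> arcs G" and r: "r \<in> verts G"
    and conn: "strongly_connected (G\<lparr>arcs := T\<rparr>)"
  obtains \<phi> where "\<phi> \<in> arborescences G r" "{e. \<exists>v \<in> verts G. \<phi> v = Some e} \<subseteq> T"
proof -
  let ?H = "G\<lparr>arcs := T\<rparr>"
  interpret H: wf_digraph ?H using wf_sub[OF T] .
  define d where "d v = (LEAST n. \<exists>p. H.awalk v p r \<and> length p = n)" for v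
  have walk: "\<exists>p. H.awalk v p r" if "v \<in> verts G" for v
    using conn that r H.reachable_awalk unfolding strongly_connected_def by auto
  have d_le: "d v \<le> length p" if "H.awalk v p r" for v p
    unfolding d_def using that by (intro Least_le) auto
  have step: "\<exists>e. e \<in> T \<and> tail G e = v \<and> d v = Suc (d (head G e))"
    if v: "v \<in> verts G" "v \<noteq> r" for v
  proof -
    have "\<exists>n p. H.awalk v p r \<and> length p = n" using walk[OF v(1)] by blast
    from LeastI_ex[OF this] obtain p where p: "H.awalk v p r" "length p = d v"
      unfolding d_def by blast
    then obtain e q where q: "p = e # q" using v by (cases p) (auto simp: H.awalk_Nil_iff)
    have e: "e \<in> T" "tail G e = v" "H.awalk (head G e) q r"
      using p q by (auto simp: H.awalk_Cons_iff)
    have "\<exists>n p. H.awalk (head G e) p r \<and> length p = n" using e by blast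
    from LeastI_ex[OF this] obtain q' where q': "H.awalk (head G e) q' r" "length q' = d (head G e)"
      unfolding d_def by blast
    have "d v \<le> Suc (d (head G e))"
      using d_le[of v "e # q'"] q' e by (auto simp: H.awalk_Cons_iff)
    moreover have "Suc (d (head G e)) \<le> d v" using d_le[OF e(3)] p q by simp
    ultimately show ?thesis using e by auto
  qed
  then obtain f where f: "\<And>v. v \<in> verts G \<Longrightarrow> v \<noteq> r \<Longrightarrow>
      f v \<in> T \<and> tail G (f v) = v \<and> d v = Suc (d (head G (f v)))" by metis
  define \<phi> where "\<phi> = (\<lambda>v \<in> verts G. if v = r then None else Some (f v))"
  have "f v \<in> out_arcs G v" if "v \<in> verts G" "v \<noteq> r" for v using f[OF that] T by auto
  moreover have "d r = 0" using d_le[of r "[]"] r by (simp add: H.awalk_Nil_iff)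
  ultimately have "\<phi> \<in> arborescences G r"
    unfolding arborescences_def ranked_def using f
    by (auto simp: \<phi>_def intro!: exI[of _ d])
  moreover have "{e. \<exists>v \<in> verts G. \<phi> v = Some e} \<subseteq> T"
    using f by (auto simp: \<phi>_def split: if_splits)
  ultimately show thesis using that by blast
qed

text \<open>A path does not return to a vertex, so no arc after \<open>a\<close> ends at the tail of
  \<open>a\<close>, whereas the inverse of \<open>a\<close> does.\<close>

lemma apath_no_reversal:
  assumes "T \<subseteq> arcs G" "pre_digraph.apath (G\<lparr>arcs := T\<rparr>) u p w" "e \<in> set p"
  shows "arev e \<notin> set p"
proof -
  let ?H = "G\<lparr>arcs := T\<rparr>"
  interpret H: wf_digraph ?H using wf_sub[OF assms(1)] .
  have heads: "head G e \<in> set (H.awalk_verts u p)" if "H.awalk u p w" "e \<in> set p" for e u p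
    using that H.awalk_verts_conv'[of u p w] by (auto simp: H.awalk_def)
  show ?thesis using assms(2,3)
  proof (induction p arbitrary: u)
    case (Cons a p)
    have a: "a \<in> arcs G" "H.apath (head G a) p w" "tail G a \<notin> set (H.awalk_verts (head G a) p)"
      using Cons.prems assms(1) by (auto simp: H.apath_Cons_iff)
    have "head G f \<noteq> tail G a" if "f \<in> set p" for f
      using heads[OF H.awalkI_apath[OF a(2)] that] a by auto
    moreover have "arev a \<noteq> a" "head G (arev a) = tail G a" using a arev_neq by auto
    ultimately show ?case using Cons a by (metis arev_arev set_ConsD)
  qed simp
qed

text \<open>A spanning tree contains the arcs of an arborescence, which already connect everything.
  A further arc would close a path of these arcs to a circuit; the inverse of the new arc is not
  among them either, so the circuit contains no reversal.\<close>

lemma tree_arcs_surj: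
  assumes T: "T \<in> spanning_trees G arev" and r: "r \<in> verts G"
  shows "\<exists>\<phi> \<in> arborescences G r. tree_arcs G arev \<phi> = T"
proof -
  have sub: "T \<subseteq> arcs G" and rev: "\<And>e. e \<in> T \<Longrightarrow> arev e \<in> T"
    and conn: "strongly_connected (G\<lparr>arcs := T\<rparr>)"
    and tree: "\<And>q. \<not> serre_circuit (G\<lparr>arcs := T\<rparr>) arev q"
    using T by (auto simp: spanning_trees_def serre_tree_def)
  obtain \<phi> where phi: "\<phi> \<in> arborescences G r" "{e. \<exists>v \<in> verts G. \<phi> v = Some e} \<subseteq> T"
    using connected_imp_arborescence[OF sub r conn] .
  let ?S = "tree_arcs G arev \<phi>" and ?K = "G\<lparr>arcs := T\<rparr>"
  let ?H = "G\<lparr>arcs := ?S\<rparr>"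
  have ST: "?S \<subseteq> T" using phi(2) rev by (auto simp: tree_arcs_def)
  have "T \<subseteq> ?S"
  proof
    fix e assume e: "e \<in> T"
    show "e \<in> ?S"
    proof (rule ccontr)
      assume nS: "e \<notin> ?S"
      interpret H: wf_digraph ?H using wf_sub ST sub by blast
      interpret K: wf_digraph ?K using wf_sub sub .
      have "head G e \<rightarrow>\<^sup>*\<^bsub>?H\<^esub> tail G e"
        using tree_arcs_connected[OF phi(1) r] e sub by (auto simp: strongly_connected_def)
      then obtain p where p: "H.apath (head G e) p (tail G e)" using H.reachable_apath by blast
      have pS: "set p \<subseteq> ?S" using p by (auto simp: H.apath_def H.awalk_def)
      have verts: "K.awalk_verts u q = H.awalk_verts u q" for u q
        by (induction q arbitrary: u) auto
      have cas: "K.cas u q w = H.cas u q w" for u q w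
        by (induction q arbitrary: u) auto
      have "K.awalk (tail G e) (e # p) (tail G e)"
        using p e sub ST unfolding K.awalk_Cons_iff
        by (auto simp: K.awalk_def H.apath_def H.awalk_def cas)
      moreover have "distinct (tl (K.awalk_verts (tail G e) (e # p)))"
        using p by (simp add: verts H.apath_def)
      ultimately have "K.cycle (e # p)" unfolding K.cycle_def by blast
      moreover have "arev f \<notin> set (e # p)" if "f \<in> set (e # p)" for f
      proof -
        have "arev e \<notin> ?S" using nS tree_arcs_arev[of "arev e" \<phi>] by auto
        hence "arev e \<notin> set (e # p)" using pS arev_neq e sub by auto
        moreover have "arev f \<noteq> e" if "f \<in> set p" for f
          using that pS tree_arcs_arev nS by blast
        moreover have "arev f \<notin> set p" if "f \<in> set p" for f
          using apath_no_reversal[OF _ p that] ST sub by blast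
        ultimately show ?thesis using that by auto
      qed
      ultimately show False using tree[of "e # p"] by (auto simp: serre_circuit_def)
    qed
  qed
  with ST phi show ?thesis by blast
qed

text \<open>The number is the same for every root. This is what allows a whole fibre of vertices to
  serve as possible roots.\<close>

theorem card_arborescences:
  assumes r: "r \<in> verts G"
  shows "card (arborescences G r) = kappa G arev"
proof -
  have "bij_betw (tree_arcs G arev) (arborescences G r) (spanning_trees G arev)"
  proof (rule bij_betwI')
    fix \<phi> assume phi: "\<phi> \<in> arborescences G r"
    show "tree_arcs G arev \<phi> \<in> spanning_trees G arev"
      using tree_arcs_subset[OF phi r] tree_arcs_connected[OF phi r] tree_arcs_no_circuit[OF phi r]
        tree_arcs_arev by (auto simp: spanning_trees_def serre_tree_def)
  next
    fix T assume "T \<in> spanning_trees G arev"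
    thus "\<exists>\<phi> \<in> arborescences G r. T = tree_arcs G arev \<phi>" using tree_arcs_surj r by blast
  qed (use tree_arcs_inj r in blast)
  thus ?thesis unfolding kappa_def by (rule bij_betw_same_card)
qed

text \<open>Connectedness of the covers enters through this positivity: it keeps the Ihara
  polynomial from vanishing at roots of unity other than 1.\<close>

lemma kappa_pos:
  assumes "finite (verts G)" "finite (arcs G)" "strongly_connected G"
  shows "kappa G arev > 0"
proof -
  have "G\<lparr>arcs := arcs G\<rparr> = G" by simp
  moreover obtain r where r: "r \<in> verts G" using assms(3) by (auto simp: strongly_connected_def)
  ultimately obtain \<phi> where phi: "\<phi> \<in> arborescences G r"
    by (rule_tac connected_imp_arborescence[of "arcs G" r]) (use assms in auto)
  have "finite (arborescences G r)"
    unfolding arborescences_def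
    by (rule finite_subset[of _ "PiE (verts G) (\<lambda>v. insert None (Some ` arcs G))"])
       (use assms in \<open>auto intro!: finite_PiE simp: PiE_iff extensional_def split: if_splits\<close>)
  with phi have "card (arborescences G r) > 0" by (auto simp: card_gt_0_iff)
  thus ?thesis using card_arborescences[OF r] by simp
qed

end

section \<open>The weighted matrix tree theorem\<close>

text \<open>If there is a rank, a nonzero Leibniz term fixes an index or follows \<open>h\<close>,
  so its permutation never raises the rank; as it preserves the sum of all ranks, it never lowers
  one either and is the identity. If there is none, the indicator of the points whose orbit never
  stops is a nonzero kernel vector.\<close>

lemma ranked_det:
  fixes h :: "'v \<Rightarrow> 'v option" and f :: "nat \<Rightarrow> 'v"
  assumes f: "bij_betw f {0..<m} V" and h: "\<And>v w. v \<in> V \<Longrightarrow> h v = Some w \<Longrightarrow> w \<in> V"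
  shows "det (mat m m (\<lambda>(i, j). (if i = j then 1 else 0) - (if h (f i) = Some (f j) then 1 else 0)) :: int mat)
       = (if ranked h V then 1 else 0)"
proof (cases "ranked h V")
  case True
  let ?M = "mat m m (\<lambda>(i, j). (if i = j then 1 else 0) - (if h (f i) = Some (f j) then 1 else 0)) :: int mat"
  obtain d :: "'v \<Rightarrow> nat" where d: "\<And>v. v \<in> V \<Longrightarrow> d v = (case h v of None \<Rightarrow> 0 | Some w \<Rightarrow> Suc (d w))"
    using True unfolding ranked_def by blast
  have fV: "f i \<in> V" if "i < m" for i using f that by (auto simp: bij_betw_def)
  have no_loop: "h v \<noteq> Some v" if "v \<in> V" for v using d[OF that] by auto
  have "(\<Prod>i = 0..<m. ?M $$ (i, \<pi> i)) = 0" if pi: "\<pi> permutes {0..<m}" "\<pi> \<noteq> id" for \<pi>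
  proof (rule ccontr)
    assume nz: "(\<Prod>i = 0..<m. ?M $$ (i, \<pi> i)) \<noteq> 0"
    have pm: "\<pi> i < m" if "i < m" for i using permutes_in_image[OF pi(1), of i] that by simp
    have *: "\<pi> i = i \<or> h (f i) = Some (f (\<pi> i))" if "i < m" for i
    proof -
      have "?M $$ (i, \<pi> i) \<noteq> 0" using nz that by (auto simp: prod_zero_iff)
      thus ?thesis using that pm[OF that] by (auto split: if_splits)
    qed
    have le: "d (f (\<pi> i)) \<le> d (f i)" if "i < m" for i
      using *[OF that] d[OF fV[OF that]] by auto
    have "(\<Sum>i = 0..<m. d (f (\<pi> i))) = (\<Sum>i = 0..<m. d (f i))"
      using sum.permute[OF pi(1), of "\<lambda>i. d (f i)"] by (simp add: o_def)
    hence "d (f (\<pi> i)) = d (f i)" if "i < m" for i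
      using sum_mono_inv[of "\<lambda>i. d (f (\<pi> i))" "{0..<m}" "\<lambda>i. d (f i)" i] le that by auto
    hence "\<pi> i = i" if "i < m" for i
      using *[OF that] d[OF fV[OF that]] that by fastforce
    hence "\<pi> i = i" for i using pi(1) by (cases "i < m") (auto simp: permutes_def)
    thus False using pi(2) by auto
  qed
  hence "det ?M = (\<Sum>\<pi> | \<pi> permutes {0..<m}. if \<pi> = id then 1 else 0)"
    unfolding det_def'[OF mat_carrier]
    by (intro sum.cong) (use fV no_loop in \<open>auto simp: permutes_id\<close>)
  also have "\<dots> = 1" by (simp add: finite_permutations permutes_id)
  finally show ?thesis using True by simp
next
  case False
  let ?M = "mat m m (\<lambda>(i, j). (if i = j then 1 else 0) - (if h (f i) = Some (f j) then 1 else 0)) :: int mat"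
  define step where "step = (\<lambda>x. case x of None \<Rightarrow> None | Some v \<Rightarrow> h v)"
  define U where "U = {v \<in> V. \<forall>k. (step ^^ k) (Some v) \<noteq> None}"
  have "U \<noteq> {}"
  proof
    assume "U = {}"
    hence ex: "\<exists>k. (step ^^ k) (Some v) = None" if "v \<in> V" for v using that by (auto simp: U_def)
    \<comment> \<open>Counting with \<open>Suc k\<close> gives rank 0 to a sink:
      \<open>Some v\<close> itself is never \<open>None\<close>, and one step from a sink leads to
      \<open>None\<close>.\<close>
    define d where "d v = (LEAST k. (step ^^ Suc k) (Some v) = None)" for v
    have ex': "\<exists>k. (step ^^ Suc k) (Some v) = None" if "v \<in> V" for v
    proof -
      obtain k where "(step ^^ k) (Some v) = None" using ex[OF \<open>v \<in> V\<close>] by blast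
      hence "(step ^^ Suc k) (Some v) = None" by (simp add: step_def)
      thus ?thesis by blast
    qed
    have "d v = (case h v of None \<Rightarrow> 0 | Some w \<Rightarrow> Suc (d w))" if v: "v \<in> V" for v
    proof (cases "h v")
      case None
      thus ?thesis by (simp add: d_def step_def)
    next
      case (Some w)
      have s: "(step ^^ Suc (Suc k)) (Some v) = (step ^^ Suc k) (Some w)" for k
        unfolding funpow_Suc_right[of "Suc k"] by (simp add: step_def Some)
      have "d v = Suc (LEAST k. (step ^^ Suc (Suc k)) (Some v) = None)"
        unfolding d_def
      proof (rule Least_Suc)
        show "(step ^^ Suc (d v)) (Some v) = None" unfolding d_def by (rule LeastI_ex[OF ex'[OF v]])
        show "(step ^^ Suc 0) (Some v) \<noteq> None" by (simp add: step_def Some)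
      qed
      thus ?thesis using Some unfolding s by (simp add: d_def)
    qed
    thus False using False unfolding ranked_def by blast
  qed
  \<comment> \<open>Whether an orbit stops is the same for a point and its successor, so the row at
    \<open>v\<close> annihilates the indicator of \<open>U\<close>.\<close>
  have Uh: "v \<in> U \<longleftrightarrow> (\<exists>w \<in> U. h v = Some w)" if v: "v \<in> V" for v
  proof -
    have s: "(step ^^ Suc k) (Some v) = (step ^^ k) (h v)" for k
      unfolding funpow_Suc_right by (simp add: step_def)
    have N: "(step ^^ k) None = None" for k by (induction k) (auto simp: step_def)
    have "v \<in> U \<longleftrightarrow> (\<forall>k. (step ^^ k) (h v) \<noteq> None)"
      using v s unfolding U_def mem_Collect_eq
      by (metis funpow_0 not0_implies_Suc option.distinct(1))
    also have "\<dots> \<longleftrightarrow> (\<exists>w \<in> U. h v = Some w)"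
      using h[OF v] N by (cases "h v") (auto simp: U_def)
    finally show ?thesis .
  qed
  define x where "x = vec m (\<lambda>i. if f i \<in> U then 1 else 0 :: int)"
  have "(?M *\<^sub>v x) $ i = 0" if i: "i < m" for i
  proof -
    have fi: "f i \<in> V" using f i by (auto simp: bij_betw_def)
    have "(?M *\<^sub>v x) $ i = (\<Sum>j = 0..<m. ((if i = j then 1 else 0) - (if h (f i) = Some (f j) then 1 else 0)) *
            (if f j \<in> U then 1 else 0))"
      using i by (simp add: scalar_prod_def x_def)
    also have "\<dots> = (\<Sum>j = 0..<m. (if j = i then if f i \<in> U then 1 else 0 else 0)) -
       (\<Sum>j = 0..<m. if h (f i) = Some (f j) \<and> f j \<in> U then 1 else 0)"
      unfolding sum_subtractf[symmetric] by (intro sum.cong) auto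
    also have "(\<Sum>j = 0..<m. if h (f i) = Some (f j) \<and> f j \<in> U then 1 else 0 :: int) =
       (\<Sum>w \<in> V. if h (f i) = Some w \<and> w \<in> U then 1 else 0)"
      using sum.reindex_bij_betw[OF f, of "\<lambda>w. if h (f i) = Some w \<and> w \<in> U then 1 else 0 :: int"] .
    also have "\<dots> = (\<Sum>w \<in> V. if h (f i) = Some w then (if w \<in> U then 1 else 0) else 0)"
      by (intro sum.cong) auto
    also have "\<dots> = (if f i \<in> U then 1 else 0)"
      using Uh[OF fi] h[OF fi] bij_betw_finite[OF f] by (cases "h (f i)") auto
    also have "(\<Sum>j = 0..<m. (if j = i then if f i \<in> U then 1 else 0 else 0 :: int)) = (if f i \<in> U then 1 else 0)"
      using i by simp
    finally show ?thesis by simp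
  qed
  hence "?M *\<^sub>v x = 0\<^sub>v m" by (intro eq_vecI) auto
  moreover have "x \<noteq> 0\<^sub>v m"
  proof -
    obtain u where "u \<in> U" using \<open>U \<noteq> {}\<close> by blast
    then obtain i where "i < m" "f i \<in> U" using f by (auto simp: bij_betw_def U_def)
    hence "x $ i \<noteq> 0\<^sub>v m $ i" by (simp add: x_def)
    thus ?thesis by metis
  qed
  moreover have "x \<in> carrier_vec m" by (simp add: x_def)
  ultimately have "det ?M = 0"
    using det_0_iff_vec_prod_zero[OF mat_carrier] by blast
  thus ?thesis using False by simp
qed

text \<open>Multilinearity in the rows: distributing the products of the Leibniz formula over the
  sums leaves one determinant for each way of choosing a summand in every row.\<close>

lemma det_sum_rows:
  fixes a :: "'v \<Rightarrow> 'c \<Rightarrow> 'v \<Rightarrow> 'a :: comm_ring_1" and f :: "nat \<Rightarrow> 'v"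
  assumes f: "bij_betw f {0..<m} V" and C: "\<And>v. v \<in> V \<Longrightarrow> finite (C v)"
  shows "det (mat m m (\<lambda>(i, j). \<Sum>c \<in> C (f i). a (f i) c (f j))) =
    (\<Sum>\<phi> \<in> PiE V C. det (mat m m (\<lambda>(i, j). a (f i) (\<phi> (f i)) (f j))))"
proof -
  have fin: "finite V" using f bij_betw_finite by blast
  \<comment> \<open>The choice functions live on \<open>V\<close> and the Leibniz products on
    indices; \<open>f'\<close> carries the products over to \<open>V\<close>.\<close>
  define f' where "f' = inv_into {0..<m} f"
  have f': "f' (f i) = i" if "i < m" for i
    using f that by (auto simp: f'_def bij_betw_def inv_into_f_f)
  have prod_V: "(\<Prod>i = 0..<m. g i) = (\<Prod>v \<in> V. g (f' v))" for g :: "nat \<Rightarrow> 'a"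
    using prod.reindex_bij_betw[OF f, of "\<lambda>v. g (f' v)"] f' by simp
  have ff': "f (f' v) = v" if "v \<in> V" for v
    using f that by (auto simp: f'_def bij_betw_def f_inv_into_f)
  have pm: "\<pi> i < m" if "\<pi> permutes {0..<m}" "i < m" for \<pi> i
    using permutes_in_image[OF that(1), of i] that by simp
  have "det (mat m m (\<lambda>(i, j). \<Sum>c \<in> C (f i). a (f i) c (f j))) =
    (\<Sum>\<pi> | \<pi> permutes {0..<m}. of_int (sign \<pi>) * (\<Prod>i = 0..<m. \<Sum>c \<in> C (f i). a (f i) c (f (\<pi> i))))"
    unfolding det_def'[OF mat_carrier] using pm by (intro sum.cong arg_cong2[of _ _ _ _ "(*)"] prod.cong) auto
  also have "\<dots> = (\<Sum>\<pi> | \<pi> permutes {0..<m}. of_int (sign \<pi>) *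
      (\<Sum>\<phi> \<in> PiE V C. \<Prod>i = 0..<m. a (f i) (\<phi> (f i)) (f (\<pi> i))))"
  proof (intro sum.cong refl arg_cong2[of _ _ _ _ "(*)"])
    fix \<pi>
    have "(\<Prod>i = 0..<m. \<Sum>c \<in> C (f i). a (f i) c (f (\<pi> i))) =
          (\<Prod>v \<in> V. \<Sum>c \<in> C v. a v c (f (\<pi> (f' v))))"
      unfolding prod_V by (intro prod.cong) (auto simp: ff')
    also have "\<dots> = (\<Sum>\<phi> \<in> PiE V C. \<Prod>v \<in> V. a v (\<phi> v) (f (\<pi> (f' v))))"
      by (rule prod_sum_PiE) (use fin C in auto)
    also have "\<dots> = (\<Sum>\<phi> \<in> PiE V C. \<Prod>i = 0..<m. a (f i) (\<phi> (f i)) (f (\<pi> i)))"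
      unfolding prod_V by (intro sum.cong prod.cong) (auto simp: ff')
    finally show "(\<Prod>i = 0..<m. \<Sum>c \<in> C (f i). a (f i) c (f (\<pi> i))) = \<dots>" .
  qed
  also have "\<dots> = (\<Sum>\<phi> \<in> PiE V C. \<Sum>\<pi> | \<pi> permutes {0..<m}. of_int (sign \<pi>) *
      (\<Prod>i = 0..<m. a (f i) (\<phi> (f i)) (f (\<pi> i))))"
    by (simp add: sum_distrib_left sum.swap[of _ "PiE V C"])
  also have "\<dots> = (\<Sum>\<phi> \<in> PiE V C. det (mat m m (\<lambda>(i, j). a (f i) (\<phi> (f i)) (f j))))"
    unfolding det_def'[OF mat_carrier] using pm
    by (intro sum.cong refl arg_cong2[of _ _ _ _ "(*)"] prod.cong) auto
  finally show ?thesis .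
qed

text \<open>Each row is a sum over the choices at its vertex: an outgoing arc of weight 1, or
  becoming a sink, of weight t on \<open>T\<close> and 0 elsewhere. By \<open>ranked_det\<close> a
  family of choices contributes only if it has a rank, and then t to the number of its sinks. One
  sink at least is unavoidable, and families with exactly one are the arborescences rooted in
  \<open>T\<close>.\<close>

lemma (in bidirected_digraph) det_weighted_laplacian:
  fixes f :: "nat \<Rightarrow> 'a" and T :: "'a set"
  assumes fin: "finite (arcs G)" and f: "bij_betw f {0..<m} (verts G)" and T: "T \<subseteq> verts G"
    and ne: "verts G \<noteq> {}"
  defines "M \<equiv> mat m m (\<lambda>(i, j).
      (if i = j then of_nat (card (out_arcs G (f i))) + (if f i \<in> T then monom 1 1 else 0) else 0)
        - of_nat (card {e \<in> arcs G. tail G e = f i \<and> head G e = f j})) :: 'c :: idom poly mat"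
  shows "coeff (det M) 0 = 0" and "coeff (det M) 1 = of_nat (card T * kappa G arev)"
proof -
  define C where "C v = insert None (Some ` out_arcs G v)" for v
  define w :: "'a \<Rightarrow> 'b option \<Rightarrow> 'c poly" where
    "w v c = (if c = None then if v \<in> T then monom 1 1 else 0 else 1)" for v c
  define h where "h \<phi> v = map_option (head G) (\<phi> v)" for \<phi> :: "'a \<Rightarrow> 'b option" and v
  \<comment> \<open>The row contributed by a single choice, with 1 at \<open>v\<close> and -1 at the
    vertex pointed to. For a loop it is 0, in keeping with the cancellation of loops in a
    Laplacian.\<close>
  define a :: "'a \<Rightarrow> 'b option \<Rightarrow> 'a \<Rightarrow> 'c poly" where
    "a v c u = w v c * ((if v = u then 1 else 0) - (if map_option (head G) c = Some u then 1 else 0))" for v c u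
  define N where "N \<phi> = {v \<in> verts G. \<phi> v = None}" for \<phi> :: "'a \<Rightarrow> 'b option"
  have finV: "finite (verts G)" using f bij_betw_finite by blast
  have fin_out: "finite (out_arcs G v)" for v using fin by (simp add: out_arcs_def)
  have f_inj: "f i = f j \<longleftrightarrow> i = j" if "i < m" "j < m" for i j
    using f that by (auto simp: bij_betw_def inj_on_def)
  have fV: "f i \<in> verts G" if "i < m" for i using f that by (auto simp: bij_betw_def)
  have row: "(\<Sum>c \<in> C v. a v c u) = (if v = u then of_nat (card (out_arcs G v)) + (if v \<in> T then monom 1 1 else 0) else 0)
        - of_nat (card {e \<in> arcs G. tail G e = v \<and> head G e = u})" for v u
  proof -
    have "(\<Sum>c \<in> C v. a v c u) = a v None u + (\<Sum>e \<in> out_arcs G v. a v (Some e) u)"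
      unfolding C_def using fin_out by (subst sum.insert) (auto simp: sum.reindex)
    also have "(\<Sum>e \<in> out_arcs G v. a v (Some e) u) =
        of_nat (card (out_arcs G v)) * (if v = u then 1 else 0) - (\<Sum>e \<in> out_arcs G v. if head G e = u then 1 else 0)"
      by (simp add: a_def w_def sum_subtractf)
    also have "(\<Sum>e \<in> out_arcs G v. if head G e = u then 1 else 0 :: 'c poly) =
        of_nat (card {e \<in> out_arcs G v. head G e = u})"
      using fin_out by (simp flip: sum.inter_filter)
    also have "{e \<in> out_arcs G v. head G e = u} = {e \<in> arcs G. tail G e = v \<and> head G e = u}"
      by auto
    finally show ?thesis by (auto simp: a_def w_def)
  qed
  have "M = mat m m (\<lambda>(i, j). \<Sum>c \<in> C (f i). a (f i) c (f j))"
    unfolding M_def row by (rule cong_mat) (auto simp: f_inj)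
  hence "det M = (\<Sum>\<phi> \<in> PiE (verts G) C. det (mat m m (\<lambda>(i, j). a (f i) (\<phi> (f i)) (f j))))"
    using det_sum_rows[OF f, of C a] fin_out by (simp add: C_def)
  also have "\<dots> = (\<Sum>\<phi> \<in> PiE (verts G) C. (\<Prod>v \<in> verts G. w v (\<phi> v)) * (if ranked (h \<phi>) (verts G) then 1 else 0))"
  proof (intro sum.cong refl)
    fix \<phi> assume phi: "\<phi> \<in> PiE (verts G) C"
    let ?B = "mat m m (\<lambda>(i, j). (if i = j then 1 else 0) - (if h \<phi> (f i) = Some (f j) then 1 else 0)) :: int mat"
    have hV: "u \<in> verts G" if "v \<in> verts G" "h \<phi> v = Some u" for v u
      using PiE_mem[OF phi that(1)] that by (auto simp: h_def C_def)
    have pm: "\<pi> i < m" if "\<pi> permutes {0..<m}" "i < m" for \<pi> i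
      using permutes_in_image[OF that(1), of i] that by simp
    have "det (mat m m (\<lambda>(i, j). a (f i) (\<phi> (f i)) (f j))) =
        (\<Prod>i = 0..<m. w (f i) (\<phi> (f i))) * det (map_mat of_int ?B)"
      unfolding det_def'[OF mat_carrier] det_def'[OF map_carrier_mat[THEN iffD2, OF mat_carrier]] sum_distrib_left
      using pm
      by (intro sum.cong refl)
         (auto simp: prod.distrib[symmetric] a_def h_def f_inj intro!: prod.cong)
    also have "det (map_mat of_int ?B :: 'c poly mat) = of_int (det ?B)"
      by (rule of_int_hom.hom_det)
    also have "det ?B = (if ranked (h \<phi>) (verts G) then 1 else 0)"
      by (rule ranked_det[OF f]) (use hV in auto)
    also have "(\<Prod>i = 0..<m. w (f i) (\<phi> (f i))) = (\<Prod>v \<in> verts G. w v (\<phi> v))"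
      by (rule prod.reindex_bij_betw[OF f])
    finally show "det (mat m m (\<lambda>(i, j). a (f i) (\<phi> (f i)) (f j))) =
       (\<Prod>v \<in> verts G. w v (\<phi> v)) * (if ranked (h \<phi>) (verts G) then 1 else 0)" by simp
  qed
  also have "\<dots> = (\<Sum>\<phi> \<in> PiE (verts G) C.
      if N \<phi> \<subseteq> T \<and> ranked (h \<phi>) (verts G) then monom 1 (card (N \<phi>)) else 0)"
  proof (intro sum.cong refl)
    fix \<phi>
    have "(\<Prod>v \<in> verts G. w v (\<phi> v)) = (\<Prod>v \<in> N \<phi>. if v \<in> T then monom 1 1 else 0)"
      by (rule prod.mono_neutral_cong_right) (use finV in \<open>auto simp: N_def w_def\<close>)
    also have "\<dots> = (if N \<phi> \<subseteq> T then monom 1 (card (N \<phi>)) else 0)"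
    proof (cases "N \<phi> \<subseteq> T")
      case True
      hence "(\<Prod>v \<in> N \<phi>. if v \<in> T then monom 1 1 else 0) = (\<Prod>v \<in> N \<phi>. monom (1 :: 'c) 1)"
        by (intro prod.cong) auto
      thus ?thesis using True by (simp add: monom_power)
    next
      case False
      have "finite (N \<phi>)" using finV by (simp add: N_def)
      thus ?thesis using False by (auto simp: prod_zero_iff)
    qed
    finally show "(\<Prod>v \<in> verts G. w v (\<phi> v)) * (if ranked (h \<phi>) (verts G) then 1 else 0) =
      (if N \<phi> \<subseteq> T \<and> ranked (h \<phi>) (verts G) then monom 1 (card (N \<phi>)) else 0)" by simp
  qed
  finally have det: "det M = \<dots>" .
  have finPi: "finite (PiE (verts G) C)"
    using finV fin_out by (intro finite_PiE) (auto simp: C_def)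
  have N_ne: "N \<phi> \<noteq> {}" if rk: "ranked (h \<phi>) (verts G)" and phi: "\<phi> \<in> PiE (verts G) C" for \<phi>
  proof
    assume N: "N \<phi> = {}"
    obtain d :: "'a \<Rightarrow> nat" where d: "\<And>v. v \<in> verts G \<Longrightarrow> d v = (case h \<phi> v of None \<Rightarrow> 0 | Some w \<Rightarrow> Suc (d w))"
      using rk unfolding ranked_def by blast
    \<comment> \<open>A vertex of minimal rank cannot point to a vertex, whose rank would be smaller
      still.\<close>
    define v where "v = arg_min_on d (verts G)"
    have v: "v \<in> verts G" "\<And>u. u \<in> verts G \<Longrightarrow> d v \<le> d u"
      unfolding v_def using arg_min_if_finite(1)[OF finV ne, of d] arg_min_least[OF finV ne, of _ d] by auto
    obtain e where e: "\<phi> v = Some e" using N v by (auto simp: N_def)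
    hence "e \<in> arcs G" using PiE_mem[OF phi v(1)] by (auto simp: C_def)
    hence "d v \<le> d (head G e)" using v by auto
    thus False using d[OF v(1)] e by (simp add: h_def)
  qed
  have coeff: "coeff (det M) k = of_nat (card {\<phi> \<in> PiE (verts G) C. N \<phi> \<subseteq> T \<and> ranked (h \<phi>) (verts G) \<and> card (N \<phi>) = k})"
    (is "_ = of_nat (card (?A k))") for k
  proof -
    have "coeff (det M) k = (\<Sum>\<phi> \<in> PiE (verts G) C. if N \<phi> \<subseteq> T \<and> ranked (h \<phi>) (verts G) \<and> card (N \<phi>) = k then 1 else 0)"
      unfolding det coeff_sum by (intro sum.cong) auto
    thus ?thesis using finPi by (simp flip: sum.inter_filter)
  qed
  have A0: "?A 0 = {}"
    using N_ne finV by (auto simp: N_def card_eq_0_iff)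
  show "coeff (det M) 0 = 0" unfolding coeff A0 by simp
  have "?A 1 = (\<Union>r \<in> T. arborescences G r)"
  proof (intro equalityI subsetI)
    fix \<phi> assume phi: "\<phi> \<in> ?A 1"
    then obtain r where r: "N \<phi> = {r}" by (auto simp: card_1_singleton_iff)
    hence "\<phi> v \<in> (if v = r then {None} else Some ` out_arcs G v)" if "v \<in> verts G" for v
      using phi that PiE_mem[of \<phi> "verts G" C v] by (auto simp: N_def C_def)
    hence "\<phi> \<in> PiE (verts G) (\<lambda>v. if v = r then {None} else Some ` out_arcs G v)"
      using phi by (auto simp: PiE_iff)
    moreover have "r \<in> T" using phi r by auto
    ultimately show "\<phi> \<in> (\<Union>r \<in> T. arborescences G r)"
      using phi by (auto simp: arborescences_def h_def[abs_def])
  next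
    fix \<phi> assume "\<phi> \<in> (\<Union>r \<in> T. arborescences G r)"
    then obtain r where r: "r \<in> T" and phi: "\<phi> \<in> arborescences G r" by blast
    have P: "\<phi> \<in> PiE (verts G) (\<lambda>v. if v = r then {None} else Some ` out_arcs G v)"
      using phi by (simp add: arborescences_def)
    have "\<phi> \<in> PiE (verts G) C"
      using P by (auto simp: PiE_iff C_def split: if_splits)
    moreover have "N \<phi> = {r}"
      using PiE_mem[OF P] r T by (fastforce simp: N_def split: if_splits)
    ultimately show "\<phi> \<in> ?A 1"
      using r phi by (simp add: arborescences_def h_def[abs_def])
  qed
  moreover have "card (\<Union>r \<in> T. arborescences G r) = (\<Sum>r \<in> T. card (arborescences G r))"
  proof (rule card_UN_disjoint)
    show "finite T" using T finV finite_subset by blast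
    have "arborescences G r \<subseteq> PiE (verts G) C" for r
      by (auto simp: arborescences_def PiE_iff C_def extensional_def split: if_splits)
    thus "\<forall>r \<in> T. finite (arborescences G r)" using finPi finite_subset by blast
    \<comment> \<open>The root can be read off as the only vertex with value
      \<open>None\<close>.\<close>
    have "r = s" if "\<phi> \<in> arborescences G r" "\<phi> \<in> arborescences G s" "r \<in> T" "s \<in> T" for r s \<phi>
      using arborescence_root[OF that(1)] arborescenceE[OF that(2)] that T
      by (metis option.distinct(1) subsetD)
    thus "\<forall>r \<in> T. \<forall>s \<in> T. r \<noteq> s \<longrightarrow> arborescences G r \<inter> arborescences G s = {}" by blast
  qed
  moreover have "card (arborescences G r) = kappa G arev" if "r \<in> T" for r
    using card_arborescences that T by blast
  ultimately show "coeff (det M) 1 = of_nat (card T * kappa G arev)" by (simp add: coeff)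
qed

section \<open>Laurent polynomials and block circulant determinants\<close>

definition leval :: "'a :: field_char_0 \<Rightarrow> laurent \<Rightarrow> 'a" where
  "leval z f = (\<Sum>k \<in> Poly_Mapping.keys f. of_int (Poly_Mapping.lookup f k) * z powi k)"

lemma leval_superset:
  assumes "finite S" "Poly_Mapping.keys f \<subseteq> S"
  shows "leval z f = (\<Sum>k \<in> S. of_int (Poly_Mapping.lookup f k) * z powi k)"
  unfolding leval_def
proof (rule sum.mono_neutral_left[OF assms])
  show "\<forall>k \<in> S - Poly_Mapping.keys f. of_int (Poly_Mapping.lookup f k) * z powi k = 0"
    by (metis DiffD2 in_keys_iff mult_zero_left of_int_0)
qed

lemma leval_0 [simp]: "leval z 0 = 0"
  by (simp add: leval_def)

lemma leval_single [simp]: "leval z (Poly_Mapping.single k c) = of_int c * z powi k"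
  using leval_superset[of "{k}" "Poly_Mapping.single k c" z] by (simp split: if_splits)

lemma leval_diff: "leval z (f - g) = leval z f - leval z g"
proof -
  let ?S = "Poly_Mapping.keys f \<union> Poly_Mapping.keys g"
  have "Poly_Mapping.keys (f - g) \<subseteq> ?S" by (rule keys_diff)
  thus ?thesis
    using leval_superset[of ?S f z] leval_superset[of ?S g z] leval_superset[of ?S "f - g" z]
    by (simp add: lookup_minus algebra_simps sum_subtractf)
qed

lemma leval_add: "leval z (f + g) = leval z f + leval z g"
  using leval_diff[of z "f + g" g] by (metis add_diff_cancel_right' diff_add_cancel)

text \<open>Both sides are additive in \<open>f\<close> and in \<open>g\<close>, and the Laurent
  polynomials are the free abelian group on the exponents. So monomials suffice, and for them this
  is the law of exponents.\<close>

lemma leval_mult: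
  assumes "z \<noteq> 0"
  shows "leval z (f * g) = leval z f * leval z g"
proof (induction f rule: frag_induction[OF subset_refl])
  case (2 k)
  show ?case
  proof (induction g rule: frag_induction[OF subset_refl])
    case (2 l)
    show ?case using assms by (simp add: mult_single power_int_add)
  next
    case (3 a b)
    thus ?case by (simp only: leval_diff right_diff_distrib)
  qed simp
next
  case (3 a b)
  thus ?case by (simp only: leval_diff left_diff_distrib)
qed simp

lemma leval_1 [simp]: "leval z 1 = 1"
  using leval_single[of z 0 1] by (simp only: single_one) simp

lemma comm_ring_hom_leval:
  assumes "z \<noteq> 0"
  shows "comm_ring_hom (leval z)"
proof
  show "leval z (f * g) = leval z f * leval z g" for f g by (rule leval_mult[OF assms])
qed (rule leval_0 leval_1 leval_add)+

lemma leval_shift: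
  assumes "z \<noteq> 0"
  shows "leval z f = z powi laurent_ord0 f * poly (map_poly of_int (laurent_shift f)) z"
proof -
  have "map_poly of_int (laurent_shift f) =
    (\<Sum>k \<in> Poly_Mapping.keys f. monom (of_int (Poly_Mapping.lookup f k)) (nat (k - laurent_ord0 f)) :: 'a poly)"
    unfolding laurent_shift_def by (rule poly_eqI, simp add: coeff_map_poly coeff_sum, intro sum.cong) auto
  hence "poly (map_poly of_int (laurent_shift f)) z =
    (\<Sum>k \<in> Poly_Mapping.keys f. of_int (Poly_Mapping.lookup f k) * z ^ nat (k - laurent_ord0 f))"
    by (simp add: poly_sum poly_monom)
  also have "z powi laurent_ord0 f * \<dots> = leval z f"
    unfolding leval_def sum_distrib_left
  proof (intro sum.cong refl)
    fix k assume "k \<in> Poly_Mapping.keys f"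
    hence "laurent_ord0 f \<le> k" unfolding laurent_ord0_def by (intro Min_le) auto
    hence "z powi k = z powi laurent_ord0 f * z ^ nat (k - laurent_ord0 f)"
      using assms by (simp flip: power_int_of_nat power_int_add)
    thus "z powi laurent_ord0 f * (of_int (Poly_Mapping.lookup f k) * z ^ nat (k - laurent_ord0 f)) =
          of_int (Poly_Mapping.lookup f k) * z powi k" by (simp add: mult_ac)
  qed
  finally show ?thesis ..
qed

section \<open>Block matrices: an index \<open>c\<close> stands for the block \<open>c div g\<close>
  and the position \<open>c mod g\<close>\<close>

lemma sum_div_mod:
  fixes h :: "nat \<Rightarrow> 'a :: comm_monoid_add"
  shows "(\<Sum>c = 0..<g * n. h c) = (\<Sum>s<n. \<Sum>i<g. h (i + g * s))"
proof -
  have "(\<Sum>c = 0..<g * n. h c) = (\<Sum>s<n. sum h {s * g..<s * g + g})"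
    using sum.nat_group[of h g n] by (simp add: mult.commute atLeast0LessThan)
  also have "\<dots> = (\<Sum>s<n. \<Sum>i<g. h (i + g * s))"
  proof (rule sum.cong[OF refl])
    fix s
    show "sum h {s * g..<s * g + g} = (\<Sum>i<g. h (i + g * s))"
      using sum.shift_bounds_nat_ivl[of h 0 "s * g" g]
      by (simp only: add_0 atLeast0LessThan add.commute[of g "s * g"] mult.commute[of g s])
  qed
  finally show ?thesis .
qed

lemma det_block_diag:
  fixes B :: "nat \<Rightarrow> nat \<Rightarrow> nat \<Rightarrow> 'a :: idom"
  assumes g: "g > 0"
  shows "det (mat (g * n) (g * n) (\<lambda>(a, b). if a div g = b div g then B (a div g) (a mod g) (b mod g) else 0))
       = (\<Prod>s<n. det (mat g g (\<lambda>(i, j). B s i j)))"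
proof (induction n)
  case 0
  show ?case by (simp add: det_dim_zero)
next
  case (Suc n)
  let ?h = "\<lambda>(a, b). if a div g = b div g then B (a div g) (a mod g) (b mod g) else 0"
  have d: "a div g < n" if "a < g * n" for a
    using that by (simp add: div_less_iff_less_mult mult.commute g)
  have "mat (g * Suc n) (g * Suc n) ?h =
    four_block_mat (mat (g * n) (g * n) ?h) (0\<^sub>m (g * n) g) (0\<^sub>m g (g * n)) (mat g g (\<lambda>(i, j). B n i j))"
    (is "?A = ?B")
  proof (rule eq_matI)
    fix a b assume "a < dim_row ?B" "b < dim_col ?B"
    hence ab: "a < g * n + g" "b < g * n + g" by auto
    have c: "c div g = n" "c mod g = c - g * n" if "\<not> c < g * n" "c < g * n + g" for c
    proof -
      show "c div g = n" by (rule div_nat_eqI) (use that in auto)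
      thus "c mod g = c - g * n" by (simp add: modulo_nat_def mult.commute)
    qed
    show "?A $$ (a, b) = ?B $$ (a, b)"
    proof (cases "a < g * n")
      case True
      show ?thesis
      proof (cases "b < g * n")
        case False
        with True show ?thesis using ab d[OF True] c(1)[OF False] by simp
      qed (use True ab in simp)
    next
      case False
      show ?thesis
      proof (cases "b < g * n")
        case True
        with False show ?thesis using ab d[OF True] c(1)[OF False] by simp
      next
        case b: False
        have "a - g * n < g" "b - g * n < g" using ab b False by auto
        with False b show ?thesis using ab c[OF False] c[OF b] by simp
      qed
    qed
  qed auto
  hence "det ?A = det ?B" by simp
  also have "det ?B = det (mat (g * n) (g * n) ?h) * det (mat g g (\<lambda>(i, j). B n i j))"
    by (rule det_four_block_mat_lower_left_zero) auto
  finally show ?case unfolding Suc prod.lessThan_Suc .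
qed

text \<open>Conjugation by the character table of the cyclic group.\<close>

lemma det_fourier_blocks:
  fixes K :: "nat \<Rightarrow> nat \<Rightarrow> nat \<Rightarrow> nat \<Rightarrow> 'a :: {idom, ring_char_0}" and z :: "nat \<Rightarrow> 'a"
  assumes g: "g > 0" and n: "n > 0"
    and z: "\<And>s. s < n \<Longrightarrow> z s ^ n = 1" "inj_on z {..<n}"
    and K: "\<And>i j \<sigma> s. i < g \<Longrightarrow> j < g \<Longrightarrow> \<sigma> < n \<Longrightarrow> s < n \<Longrightarrow>
              (\<Sum>\<tau><n. K i j \<sigma> \<tau> * z s ^ \<tau>) = z s ^ \<sigma> * B s i j"
  shows "det (mat (g * n) (g * n) (\<lambda>(a, b). K (a mod g) (b mod g) (a div g) (b div g)))
       = (\<Prod>s<n. det (mat g g (\<lambda>(i, j). B s i j)))"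
proof -
  let ?N = "g * n"
  define M where "M = mat ?N ?N (\<lambda>(a, b). K (a mod g) (b mod g) (a div g) (b div g))"
  define F where "F = mat ?N ?N (\<lambda>(a, b). if a mod g = b mod g then z (b div g) ^ (a div g) else 0)"
  \<comment> \<open>As \<open>z s ^ n = 1\<close>, the power \<open>z s ^ (n - 1)\<close> is the
    inverse of \<open>z s\<close>, available without division in the ring. Orthogonality of
    characters makes \<open>F'\<close> equal to \<open>n\<close> times the inverse of
    \<open>F\<close>, which gives \<open>det F \<noteq> 0\<close>.\<close>
  define F' where "F' = mat ?N ?N (\<lambda>(a, b). if a mod g = b mod g then (z (a div g) ^ (n - 1)) ^ (b div g) else 0)"
  define D where "D = mat ?N ?N (\<lambda>(a, b). if a div g = b div g then B (a div g) (a mod g) (b mod g) else 0)"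
  have carr: "M \<in> carrier_mat ?N ?N" "F \<in> carrier_mat ?N ?N" "F' \<in> carrier_mat ?N ?N" "D \<in> carrier_mat ?N ?N"
    by (auto simp: M_def F_def F'_def D_def)
  have d: "a div g < n" "a mod g < g" if "a < ?N" for a
    using that g by (auto simp: div_less_iff_less_mult mult.commute)
  have times: "(\<Sum>c = 0..<?N. h (c mod g) (c div g)) = (\<Sum>s<n. \<Sum>i<g. h i s)" for h :: "nat \<Rightarrow> nat \<Rightarrow> 'a"
    unfolding sum_div_mod using g by (intro sum.cong refl) auto
  \<comment> \<open>By the hypothesis on \<open>K\<close>, the columns of \<open>F\<close> belonging
    to block \<open>s\<close> span a space that \<open>M\<close> preserves, acting there by
    \<open>B s\<close>.\<close>
  have "M * F = F * D"
  proof (rule eq_matI)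
    fix a b assume "a < dim_row (F * D)" "b < dim_col (F * D)"
    hence ab: "a < ?N" "b < ?N" using carr by auto
    have "(M * F) $$ (a, b) = (\<Sum>c = 0..<?N. K (a mod g) (c mod g) (a div g) (c div g) *
        (if c mod g = b mod g then z (b div g) ^ (c div g) else 0))"
      using ab by (simp add: M_def F_def scalar_prod_def)
    also have "\<dots> = (\<Sum>\<tau><n. \<Sum>j<g. if j = b mod g then K (a mod g) j (a div g) \<tau> * z (b div g) ^ \<tau> else 0)"
      unfolding times[of "\<lambda>j \<tau>. K (a mod g) j (a div g) \<tau> * (if j = b mod g then z (b div g) ^ \<tau> else 0)"]
      by (intro sum.cong refl) auto
    also have "\<dots> = (\<Sum>\<tau><n. K (a mod g) (b mod g) (a div g) \<tau> * z (b div g) ^ \<tau>)"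
      using d[OF ab(2)] by simp
    also have "\<dots> = z (b div g) ^ (a div g) * B (b div g) (a mod g) (b mod g)"
      using d[OF ab(1)] d[OF ab(2)] by (intro K) auto
    also have "\<dots> = (\<Sum>s<n. \<Sum>j<g. if s = b div g \<and> j = a mod g then z s ^ (a div g) * B s j (b mod g) else 0)"
    proof -
      have "(\<Sum>s<n. \<Sum>j<g. if s = b div g \<and> j = a mod g then z s ^ (a div g) * B s j (b mod g) else 0)
          = (\<Sum>s<n. if s = b div g then \<Sum>j<g. if j = a mod g then z s ^ (a div g) * B s j (b mod g) else 0 else 0)"
        by (intro sum.cong refl) auto
      also have "\<dots> = z (b div g) ^ (a div g) * B (b div g) (a mod g) (b mod g)"
        using d[OF ab(1)] d[OF ab(2)] by simp
      finally show ?thesis ..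
    qed
    also have "\<dots> = (\<Sum>c = 0..<?N. (if a mod g = c mod g then z (c div g) ^ (a div g) else 0) *
        (if c div g = b div g then B (c div g) (c mod g) (b mod g) else 0))"
      unfolding times[of "\<lambda>j s. (if a mod g = j then z s ^ (a div g) else 0) * (if s = b div g then B s j (b mod g) else 0)"]
      by (intro sum.cong refl) auto
    also have "\<dots> = (F * D) $$ (a, b)"
      using ab by (simp add: D_def F_def scalar_prod_def)
    finally show "(M * F) $$ (a, b) = (F * D) $$ (a, b)" .
  qed (use carr in auto)
  hence "det M * det F = det F * det D"
    using det_mult carr by metis
  moreover have "det F \<noteq> 0"
  proof
    assume "det F = 0"
    have "F' * F = of_nat n \<cdot>\<^sub>m 1\<^sub>m ?N"
    proof (rule eq_matI)
      fix a b assume "a < dim_row (of_nat n \<cdot>\<^sub>m 1\<^sub>m ?N :: 'a mat)" "b < dim_col (of_nat n \<cdot>\<^sub>m 1\<^sub>m ?N :: 'a mat)"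
      hence ab: "a < ?N" "b < ?N" by auto
      define x where "x = z (a div g) ^ (n - 1) * z (b div g)"
      have "(F' * F) $$ (a, b) = (\<Sum>c = 0..<?N. (if a mod g = c mod g then (z (a div g) ^ (n - 1)) ^ (c div g) else 0) *
          (if c mod g = b mod g then z (b div g) ^ (c div g) else 0))"
        using ab by (simp add: F'_def F_def scalar_prod_def)
      also have "\<dots> = (\<Sum>\<tau><n. \<Sum>j<g. if j = a mod g then if a mod g = b mod g then x ^ \<tau> else 0 else 0)"
        unfolding times[of "\<lambda>j \<tau>. (if a mod g = j then (z (a div g) ^ (n - 1)) ^ \<tau> else 0) * (if j = b mod g then z (b div g) ^ \<tau> else 0)"]
        by (intro sum.cong refl) (auto simp: x_def power_mult_distrib)
      also have "\<dots> = (if a mod g = b mod g then \<Sum>\<tau><n. x ^ \<tau> else 0)"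
        using d[OF ab(1)] by simp
      also have "\<dots> = (if a = b then of_nat n else 0)"
      proof (cases "a mod g = b mod g")
        case True
        have za: "z (a div g) ^ (n - 1) * z (a div g) = 1"
          using z(1)[of "a div g"] d[OF ab(1)] power_minus_mult[OF n] by metis
        show ?thesis
        proof (cases "a = b")
          case True
          thus ?thesis using za by (simp add: x_def)
        next
          case False
          hence "a div g \<noteq> b div g" using \<open>a mod g = b mod g\<close> by (metis div_mult_mod_eq)
          hence "z (a div g) \<noteq> z (b div g)" using z(2) d ab by (auto simp: inj_on_def)
          moreover have "z (a div g) ^ (n - 1) \<noteq> 0" using za by fastforce
          ultimately have "x \<noteq> 1" using za unfolding x_def by (metis mult_left_cancel)
          moreover have "x ^ n = (z (a div g) ^ n) ^ (n - 1) * z (b div g) ^ n"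
            by (simp only: x_def power_mult_distrib power_mult[symmetric] mult.commute[of n])
          hence "x ^ n = 1" using z(1) d ab by simp
          moreover have "(x - 1) * (\<Sum>\<tau><n. x ^ \<tau>) = x ^ n - 1" by (simp add: power_diff_1_eq)
          ultimately have "(\<Sum>\<tau><n. x ^ \<tau>) = 0" by simp
          thus ?thesis using False by simp
        qed
      qed auto
      finally show "(F' * F) $$ (a, b) = (of_nat n \<cdot>\<^sub>m 1\<^sub>m ?N) $$ (a, b)" using ab by simp
    qed (use carr in auto)
    hence "det F' * det F = of_nat n ^ ?N"
      using det_mult[OF carr(3,2)] by simp
    thus False using \<open>det F = 0\<close> n by simp
  qed
  ultimately have "det M = det D" by simp
  thus ?thesis unfolding M_def D_def det_block_diag[OF g] .
qed

section \<open>Spanning trees of cyclic covers\<close>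

lemma bidirected_cyclic_cover:
  assumes "bidirected_digraph X bar" "voltage_assignment X bar integer_group \<alpha>" "n > 0"
  shows "bidirected_digraph (cyclic_cover X \<alpha> n) (cyclic_cover_bar X bar \<alpha> n)"
proof -
  interpret X: bidirected_digraph X bar by fact
  have "voltage_assignment X bar (integer_mod_group n) (voltage_mod \<alpha> n)"
    using assms(2,3)
    by (auto simp: voltage_assignment_def voltage_mod_def carrier_integer_mod_group mod_minus_eq)
  thus ?thesis
    unfolding cyclic_cover_def cyclic_cover_bar_def
    by (intro bidirected_derived_graph assms(1)) auto
qed

lemma cyclic_cover_simps:
  assumes "n > 0"
  shows "verts (cyclic_cover X \<alpha> n) = verts X \<times> {0..<int n}"
    and "arcs (cyclic_cover X \<alpha> n) = arcs X \<times> {0..<int n}"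
    and "tail (cyclic_cover X \<alpha> n) = (\<lambda>(e, \<sigma>). (tail X e, \<sigma>))"
    and "head (cyclic_cover X \<alpha> n) = (\<lambda>(e, \<sigma>). (head X e, (\<sigma> + \<alpha> e) mod int n))"
  using assms by (auto simp: cyclic_cover_def derived_graph_def carrier_integer_mod_group
      voltage_mod_def mod_add_right_eq)

text \<open>The Ihara matrix at \<open>z\<close> with the variable t added at the first vertex. It
  is the block at the character with value \<open>z\<close> of the Laplacian of a cover whose
  possible sinks form the fibre over that vertex.\<close>

definition twisted_laplacian ::
    "('v, 'e) pre_digraph \<Rightarrow> ('e \<Rightarrow> int) \<Rightarrow> 'v list \<Rightarrow> 'a :: field_char_0 \<Rightarrow> 'a poly mat" where
  "twisted_laplacian X \<alpha> vs z = mat (length vs) (length vs) (\<lambda>(i, j).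
     (if i = j then of_nat (card (out_arcs X (vs ! i))) + (if i = 0 then monom 1 1 else 0) else 0)
       - (\<Sum>e \<in> {e \<in> arcs X. tail X e = vs ! i \<and> head X e = vs ! j}. [:z powi \<alpha> e:]))"

text \<open>Setting t to 0 and evaluating at \<open>z\<close> are both ring homomorphisms, hence
  commute with the determinant, and the matrix entries agree.\<close>

lemma coeff_0_det_twisted_laplacian:
  assumes z: "z \<noteq> 0"
  shows "coeff (det (twisted_laplacian X \<alpha> vs z)) 0 = leval z (ihara_poly X \<alpha> vs)"
proof -
  interpret L: comm_ring_hom "leval z" using comm_ring_hom_leval z .
  have nat: "leval z (of_nat k) = of_nat k" for k by (induction k) (auto simp: leval_add)
  have nat': "coeff (of_nat k :: 'a poly) 0 = of_nat k" for k by (simp flip: poly_0_coeff_0)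
  interpret P: comm_ring_hom "\<lambda>q :: 'a poly. coeff q 0"
    by unfold_locales (auto simp: coeff_mult)
  have "map_mat (\<lambda>q. coeff q 0) (twisted_laplacian X \<alpha> vs z) = map_mat (leval z) (ihara_matrix X \<alpha> vs)"
    by (rule eq_matI)
       (auto simp: twisted_laplacian_def ihara_matrix_def L.hom_sum L.hom_minus coeff_sum out_arcs_def nat nat')
  thus ?thesis unfolding ihara_poly_def by (metis L.hom_det P.hom_det)
qed

lemma card_cover_arcs:
  assumes "n > 0"
  shows "card (out_arcs (cyclic_cover X \<alpha> n) (v, \<sigma>)) = (if \<sigma> \<in> {0..<int n} then card (out_arcs X v) else 0)"
proof (cases "\<sigma> \<in> {0..<int n}")
  case True
  hence "out_arcs (cyclic_cover X \<alpha> n) (v, \<sigma>) = (\<lambda>e. (e, \<sigma>)) ` out_arcs X v"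
    using assms by (auto simp: out_arcs_def cyclic_cover_simps)
  thus ?thesis using True by (simp add: card_image inj_on_def)
next
  case False
  hence "out_arcs (cyclic_cover X \<alpha> n) (v, \<sigma>) = {}"
    using assms by (auto simp: out_arcs_def cyclic_cover_simps)
  thus ?thesis using False by (simp only: card.empty if_False)
qed

text \<open>An arc \<open>e\<close> leads from sheet \<open>\<sigma>\<close> to sheet
  \<open>\<sigma> + \<alpha> e\<close> modulo \<open>n\<close>. In the sum of the entries against
  powers of \<open>z s\<close>, the factor \<open>z s ^ \<sigma>\<close> comes out and
  \<open>e\<close> leaves \<open>z s powi \<alpha> e\<close>. The character table is used over the
  polynomial ring, as constant polynomials, since the entries contain t.\<close>

lemma det_cover_laplacian:
  fixes X :: "('v, 'e) pre_digraph" and z :: "nat \<Rightarrow> 'a :: field_char_0"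
  assumes fin: "finite (arcs X)" and n: "n > 0" and vs: "vs \<noteq> []"
    and z: "\<And>s. s < n \<Longrightarrow> z s ^ n = 1" "inj_on z {..<n}"
  defines "g \<equiv> length vs"
  shows "det (mat (g * n) (g * n) (\<lambda>(a, b).
      (if a = b then of_nat (card (out_arcs X (vs ! (a mod g)))) + (if a mod g = 0 then monom 1 1 else 0) else 0)
       - of_nat (card {e \<in> arcs X. tail X e = vs ! (a mod g) \<and> head X e = vs ! (b mod g) \<and>
                        (int (a div g) + \<alpha> e) mod int n = int (b div g)})) :: 'a poly mat)
    = (\<Prod>s<n. det (twisted_laplacian X \<alpha> vs (z s)))"
proof -
  have g: "g > 0" using vs by (simp add: g_def)
  define E where "E i j = {e \<in> arcs X. tail X e = vs ! i \<and> head X e = vs ! j}" for i j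
  define d where "d i = of_nat (card (out_arcs X (vs ! i))) + (if i = 0 then monom 1 1 else 0 :: 'a poly)" for i
  define K where "K i j \<sigma> \<tau> = (if i = j \<and> \<sigma> = \<tau> then d i else 0) -
     of_nat (card {e \<in> E i j. (int \<sigma> + \<alpha> e) mod int n = int \<tau>})" for i j \<sigma> \<tau>
  define B where "B s i j = (if i = j then d i else 0) - (\<Sum>e \<in> E i j. [:z s powi \<alpha> e:])" for s i j
  have finE: "finite (E i j)" for i j using fin by (simp add: E_def)
  have z0: "z s \<noteq> 0" if "s < n" for s using z(1)[OF that] n by (auto simp: power_0_left)
  \<comment> \<open>Powers of an \<open>n\<close>-th root of unity depend only on the exponent
    modulo \<open>n\<close>.\<close>
  have zmod: "z s ^ nat (k mod int n) = z s powi k" if "s < n" for s k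
  proof -
    have "z s powi k = z s powi (int n * (k div int n) + k mod int n)" by simp
    also have "\<dots> = (z s ^ n) powi (k div int n) * z s powi (k mod int n)"
      using z0[OF that] by (subst power_int_add) (auto simp: power_int_mult)
    also have "\<dots> = z s ^ nat (k mod int n)"
      using z(1)[OF that] n by (simp add: power_int_def)
    finally show ?thesis ..
  qed
  have "(\<Sum>\<tau><n. K i j \<sigma> \<tau> * [:z s:] ^ \<tau>) = [:z s:] ^ \<sigma> * B s i j"
    if ij: "i < g" "j < g" "\<sigma> < n" "s < n" for i j \<sigma> s
  proof -
    have "(\<Sum>\<tau><n. of_nat (card {e \<in> E i j. (int \<sigma> + \<alpha> e) mod int n = int \<tau>}) * [:z s:] ^ \<tau>) =
       (\<Sum>\<tau><n. \<Sum>e \<in> E i j. if (int \<sigma> + \<alpha> e) mod int n = int \<tau> then [:z s:] ^ \<tau> else 0)"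
      using finE by (simp flip: sum.inter_filter)
    also have "\<dots> = (\<Sum>e \<in> E i j. \<Sum>\<tau><n. if (int \<sigma> + \<alpha> e) mod int n = int \<tau> then [:z s:] ^ \<tau> else 0)"
      by (rule sum.swap)
    also have "\<dots> = (\<Sum>e \<in> E i j. [:z s:] ^ \<sigma> * [:z s powi \<alpha> e:])"
    proof (rule sum.cong[OF refl])
      fix e
      define t where "t = nat ((int \<sigma> + \<alpha> e) mod int n)"
      have t: "int t = (int \<sigma> + \<alpha> e) mod int n" "t < n" using n by (auto simp: t_def nat_less_iff)
      have "(\<Sum>\<tau><n. if (int \<sigma> + \<alpha> e) mod int n = int \<tau> then [:z s:] ^ \<tau> else 0) =
            (\<Sum>\<tau><n. if \<tau> = t then [:z s:] ^ \<tau> else 0)"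
        by (intro sum.cong) (auto simp flip: t(1))
      also have "\<dots> = [:z s ^ t:]" using t by (simp add: poly_const_pow)
      also have "z s ^ t = z s ^ \<sigma> * z s powi \<alpha> e"
        unfolding t_def zmod[OF ij(4)] using z0[OF ij(4)] by (simp add: power_int_add)
      finally show "(\<Sum>\<tau><n. if (int \<sigma> + \<alpha> e) mod int n = int \<tau> then [:z s:] ^ \<tau> else 0) =
        [:z s:] ^ \<sigma> * [:z s powi \<alpha> e:]" by (simp add: poly_const_pow)
    qed
    finally have 1: "(\<Sum>\<tau><n. of_nat (card {e \<in> E i j. (int \<sigma> + \<alpha> e) mod int n = int \<tau>}) * [:z s:] ^ \<tau>) =
       [:z s:] ^ \<sigma> * (\<Sum>e \<in> E i j. [:z s powi \<alpha> e:])" by (simp add: sum_distrib_left)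
    have "(\<Sum>\<tau><n. (if i = j \<and> \<sigma> = \<tau> then d i else 0) * [:z s:] ^ \<tau>) =
          (\<Sum>\<tau><n. if \<tau> = \<sigma> then (if i = j then d i else 0) * [:z s:] ^ \<tau> else 0)"
      by (intro sum.cong) auto
    hence "(\<Sum>\<tau><n. (if i = j \<and> \<sigma> = \<tau> then d i else 0) * [:z s:] ^ \<tau>) = (if i = j then d i else 0) * [:z s:] ^ \<sigma>"
      using ij by simp
    moreover have "(\<Sum>\<tau><n. K i j \<sigma> \<tau> * [:z s:] ^ \<tau>) =
      (\<Sum>\<tau><n. (if i = j \<and> \<sigma> = \<tau> then d i else 0) * [:z s:] ^ \<tau>) -
      (\<Sum>\<tau><n. of_nat (card {e \<in> E i j. (int \<sigma> + \<alpha> e) mod int n = int \<tau>}) * [:z s:] ^ \<tau>)"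
      unfolding K_def left_diff_distrib sum_subtractf ..
    ultimately show ?thesis
      unfolding B_def right_diff_distrib 1 by (simp only: mult.commute)
  qed
  moreover have "inj_on (\<lambda>s. [:z s:]) {..<n}" using z(2) by (auto simp: inj_on_def)
  moreover have "[:z s:] ^ n = 1" if "s < n" for s using z(1)[OF that] by (simp add: poly_const_pow)
  ultimately have det: "det (mat (g * n) (g * n) (\<lambda>(a, b). K (a mod g) (b mod g) (a div g) (b div g)))
       = (\<Prod>s<n. det (mat g g (\<lambda>(i, j). B s i j)))"
    using det_fourier_blocks[OF g n, of "\<lambda>s. [:z s:]" K B] by blast
  have B: "mat g g (\<lambda>(i, j). B s i j) = twisted_laplacian X \<alpha> vs (z s)" for s
    unfolding twisted_laplacian_def B_def E_def d_def g_def ..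
  have K: "mat (g * n) (g * n) (\<lambda>(a, b). K (a mod g) (b mod g) (a div g) (b div g)) =
    mat (g * n) (g * n) (\<lambda>(a, b).
      (if a = b then of_nat (card (out_arcs X (vs ! (a mod g)))) + (if a mod g = 0 then monom 1 1 else 0) else 0)
       - of_nat (card {e \<in> arcs X. tail X e = vs ! (a mod g) \<and> head X e = vs ! (b mod g) \<and>
                        (int (a div g) + \<alpha> e) mod int n = int (b div g)}))"
  proof (rule cong_mat)
    fix a b
    have "a mod g = b mod g \<and> a div g = b div g \<longleftrightarrow> a = b" by (metis div_mult_mod_eq)
    thus "(case (a, b) of (a, b) \<Rightarrow> K (a mod g) (b mod g) (a div g) (b div g)) =
      (case (a, b) of (a, b) \<Rightarrow>
      (if a = b then of_nat (card (out_arcs X (vs ! (a mod g)))) + (if a mod g = 0 then monom 1 1 else 0) else 0)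
       - of_nat (card {e \<in> arcs X. tail X e = vs ! (a mod g) \<and> head X e = vs ! (b mod g) \<and>
                        (int (a div g) + \<alpha> e) mod int n = int (b div g)}))"
      by (simp add: K_def d_def E_def conj_assoc)
  qed auto
  show ?thesis using det unfolding K B .
qed

lemma coeff_prod_poly_zero_factor:
  fixes P :: "'i \<Rightarrow> 'a :: comm_ring_1 poly"
  assumes "finite I" "i \<in> I" "coeff (P i) 0 = 0"
  shows "coeff (\<Prod>i \<in> I. P i) 1 = coeff (P i) 1 * (\<Prod>j \<in> I - {i}. coeff (P j) 0)"
proof -
  have "(\<Prod>i \<in> I. P i) = P i * (\<Prod>j \<in> I - {i}. P j)" using assms by (intro prod.remove) auto
  hence "coeff (\<Prod>i \<in> I. P i) 1 = coeff (P i) 1 * coeff (\<Prod>j \<in> I - {i}. P j) 0"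
    using assms(3) by (simp add: coeff_mult)
  also have "coeff (\<Prod>j \<in> I - {i}. P j) 0 = (\<Prod>j \<in> I - {i}. coeff (P j) 0)"
    by (simp add: poly_prod flip: poly_0_coeff_0)
  finally show ?thesis .
qed

text \<open>The matrix tree theorem for the cover, with the fibre over \<open>vs ! 0\<close> as set
  of possible sinks. This fibre has \<open>n\<close> elements, whence the factor
  \<open>n\<close>.\<close>

lemma coeffs_prod_twisted_laplacian:
  fixes X :: "('v, 'e) pre_digraph" and z :: "nat \<Rightarrow> 'a :: field_char_0"
  assumes X: "bidirected_digraph X bar" and fin: "finite (arcs X)"
    and ne: "verts X \<noteq> {}"
    and volt: "voltage_assignment X bar integer_group \<alpha>"
    and vs: "distinct vs" "set vs = verts X"
    and n: "n > 0" and z: "\<And>s. s < n \<Longrightarrow> z s ^ n = 1" "inj_on z {..<n}"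
  shows "coeff (\<Prod>s<n. det (twisted_laplacian X \<alpha> vs (z s))) 0 = 0"
    and "coeff (\<Prod>s<n. det (twisted_laplacian X \<alpha> vs (z s))) 1 =
      of_nat (n * kappa (cyclic_cover X \<alpha> n) (cyclic_cover_bar X bar \<alpha> n))"
proof -
  let ?Y = "cyclic_cover X \<alpha> n" and ?bar = "cyclic_cover_bar X bar \<alpha> n"
  define g where "g = length vs"
  have g: "g > 0" using vs ne by (auto simp: g_def)
  have "vs \<noteq> []" using vs ne by auto
  interpret Y: bidirected_digraph ?Y ?bar by (rule bidirected_cyclic_cover) fact+
  \<comment> \<open>The numbering of the vertices matches the blocks: \<open>a div g\<close> is the
    sheet and \<open>a mod g\<close> the vertex below.\<close>
  define f where "f a = (vs ! (a mod g), int (a div g))" for a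
  define T where "T = {vs ! 0} \<times> {0..<int n}"
  have d: "a div g < n" "a mod g < g" if "a < g * n" for a
    using that g by (auto simp: div_less_iff_less_mult mult.commute)
  have nth_eq: "vs ! i = vs ! j \<longleftrightarrow> i = j" if "i < g" "j < g" for i j
    using vs that by (simp add: nth_eq_iff_index_eq g_def)
  have f_eq: "f a = f b \<longleftrightarrow> a = b" if "a < g * n" "b < g * n" for a b
    using nth_eq[OF d(2)[OF that(1)] d(2)[OF that(2)]] by (auto simp: f_def) (metis div_mult_mod_eq)
  have bij: "bij_betw f {0..<g * n} (verts ?Y)"
  proof (rule bij_betwI')
    fix a assume "a \<in> {0..<g * n}"
    hence "a div g < n" "a mod g < g" using d by auto
    moreover from this have "vs ! (a mod g) \<in> verts X" using vs(2) nth_mem[of "a mod g" vs] by (simp add: g_def)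
    ultimately show "f a \<in> verts ?Y" unfolding f_def cyclic_cover_simps[OF n] by simp
  next
    fix y assume "y \<in> verts ?Y"
    then obtain u k where u: "y = (u, k)" "u \<in> set vs" "0 \<le> k" "k < int n"
      using vs(2) unfolding cyclic_cover_simps[OF n] by auto
    then obtain i where "u = vs ! i" "i < g" by (auto simp: in_set_conv_nth g_def)
    moreover obtain \<sigma> where "k = int \<sigma>" using u(3) nonneg_int_cases by blast
    ultimately have y: "y = (vs ! i, int \<sigma>)" "i < g" "\<sigma> < n" using u by auto
    have "i + g * \<sigma> < g * n"
      using y mult_le_mono2[of "Suc \<sigma>" n g] by simp
    moreover have "f (i + g * \<sigma>) = y" using y by (simp add: f_def)
    ultimately show "\<exists>a \<in> {0..<g * n}. y = f a" by (intro bexI[of _ "i + g * \<sigma>"]) simp_all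
  next
    show "f a = f b \<longleftrightarrow> a = b" if "a \<in> {0..<g * n}" "b \<in> {0..<g * n}" for a b
      using f_eq[of a b] that by simp
  qed
  have T: "T \<subseteq> verts ?Y" using vs g nth_mem[of 0 vs] unfolding T_def cyclic_cover_simps[OF n] g_def by auto
  have ne': "verts ?Y \<noteq> {}" using ne n unfolding cyclic_cover_simps[OF n] by auto
  have fin': "finite (arcs ?Y)" using fin unfolding cyclic_cover_simps[OF n] by simp
  have fT: "f a \<in> T \<longleftrightarrow> a mod g = 0" if "a < g * n" for a
    using d[OF that] g nth_eq[of "a mod g" 0] by (auto simp: f_def T_def)
  have out: "card (out_arcs ?Y (f a)) = card (out_arcs X (vs ! (a mod g)))" if "a < g * n" for a
    using d[OF that] by (simp add: f_def card_cover_arcs[OF n])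
  have E: "card {e \<in> arcs ?Y. tail ?Y e = f a \<and> head ?Y e = f b} =
      card {e \<in> arcs X. tail X e = vs ! (a mod g) \<and> head X e = vs ! (b mod g) \<and>
                        (int (a div g) + \<alpha> e) mod int n = int (b div g)}" if "a < g * n" for a b
  proof -
    have "{e \<in> arcs ?Y. tail ?Y e = f a \<and> head ?Y e = f b} = (\<lambda>e. (e, int (a div g))) `
      {e \<in> arcs X. tail X e = vs ! (a mod g) \<and> head X e = vs ! (b mod g) \<and>
                        (int (a div g) + \<alpha> e) mod int n = int (b div g)}"
      using d[OF that] unfolding cyclic_cover_simps[OF n] f_def by auto
    thus ?thesis by (simp add: card_image inj_on_def)
  qed
  define M :: "'a poly mat" where "M = mat (g * n) (g * n) (\<lambda>(a, b).
      (if a = b then of_nat (card (out_arcs ?Y (f a))) + (if f a \<in> T then monom 1 1 else 0) else 0)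
        - of_nat (card {e \<in> arcs ?Y. tail ?Y e = f a \<and> head ?Y e = f b}))"
  have "M = mat (g * n) (g * n) (\<lambda>(a, b).
      (if a = b then of_nat (card (out_arcs X (vs ! (a mod g)))) + (if a mod g = 0 then monom 1 1 else 0) else 0)
       - of_nat (card {e \<in> arcs X. tail X e = vs ! (a mod g) \<and> head X e = vs ! (b mod g) \<and>
                        (int (a div g) + \<alpha> e) mod int n = int (b div g)}))"
    unfolding M_def by (rule cong_mat) (simp_all only: out fT E split)
  hence det: "det M = (\<Prod>s<n. det (twisted_laplacian X \<alpha> vs (z s)))"
    using det_cover_laplacian[OF fin n \<open>vs \<noteq> []\<close> z, of \<alpha>, folded g_def] by (simp only:)
  have "card T = n" by (simp add: T_def card_cartesian_product)
  thus "coeff (\<Prod>s<n. det (twisted_laplacian X \<alpha> vs (z s))) 0 = 0"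
    and "coeff (\<Prod>s<n. det (twisted_laplacian X \<alpha> vs (z s))) 1 = of_nat (n * kappa ?Y ?bar)"
    using Y.det_weighted_laplacian[OF fin' bij T ne', where 'c = 'a, folded M_def]
    unfolding det by simp_all
qed

text \<open>The factor at 1 of the product over roots of unity has constant coefficient 0. The
  linear coefficient of the product is thus the linear coefficient of this factor times the constant
  coefficients of the others, which are values of the Ihara polynomial.\<close>

theorem kappa_cyclic_cover:
  fixes X :: "('v, 'e) pre_digraph"
  assumes X: "bidirected_digraph X bar" and fin: "finite (arcs X)"
    and ne: "verts X \<noteq> {}"
    and volt: "voltage_assignment X bar integer_group \<alpha>"
    and vs: "distinct vs" "set vs = verts X"
    and n: "n > 0" and \<Omega>: "card {z :: 'a :: field_char_0. z ^ n = 1} = n"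
  shows "of_nat (n * kappa (cyclic_cover X \<alpha> n) (cyclic_cover_bar X bar \<alpha> n)) =
    of_nat (kappa (cyclic_cover X \<alpha> 1) (cyclic_cover_bar X bar \<alpha> 1)) *
      (\<Prod>z \<in> {z. z ^ n = 1} - {1 :: 'a}. leval z (ihara_poly X \<alpha> vs))"
    and "leval (1 :: 'a) (ihara_poly X \<alpha> vs) = 0"
proof -
  let ?\<Omega> = "{z :: 'a. z ^ n = 1}"
  define P where "P z = det (twisted_laplacian X \<alpha> vs (z :: 'a))" for z
  \<comment> \<open>The case of one sheet, where 1 is the only root of unity, determines the factor
    at 1.\<close>
  have "inj_on (\<lambda>_ :: nat. 1 :: 'a) {..<1}" by (simp add: inj_on_def)
  hence P1: "coeff (P 1) 0 = 0"
    "coeff (P 1) 1 = of_nat (kappa (cyclic_cover X \<alpha> 1) (cyclic_cover_bar X bar \<alpha> 1))"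
    using coeffs_prod_twisted_laplacian[OF X fin ne volt vs, of 1 "\<lambda>_. 1 :: 'a"]
    by (simp_all add: P_def)
  show "leval (1 :: 'a) (ihara_poly X \<alpha> vs) = 0"
    using P1 coeff_0_det_twisted_laplacian[of "1 :: 'a" X \<alpha> vs] by (simp add: P_def)
  have fin\<Omega>: "finite ?\<Omega>" using \<Omega> n card_ge_0_finite by force
  obtain z where z: "bij_betw z {0..<n} ?\<Omega>" using ex_bij_betw_nat_finite[OF fin\<Omega>] \<Omega> by auto
  have "of_nat (n * kappa (cyclic_cover X \<alpha> n) (cyclic_cover_bar X bar \<alpha> n)) = coeff (\<Prod>s<n. P (z s)) 1"
    unfolding P_def
    by (rule coeffs_prod_twisted_laplacian(2)[OF X fin ne volt vs n, symmetric])
       (use z in \<open>auto simp: bij_betw_def atLeast0LessThan\<close>)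
  also have "(\<Prod>s<n. P (z s)) = (\<Prod>z \<in> ?\<Omega>. P z)"
    using prod.reindex_bij_betw[OF z, of P] by (simp add: atLeast0LessThan)
  also have "coeff \<dots> 1 = coeff (P 1) 1 * (\<Prod>z \<in> ?\<Omega> - {1}. coeff (P z) 0)"
    by (rule coeff_prod_poly_zero_factor) (use fin\<Omega> P1 in auto)
  also have "(\<Prod>z \<in> ?\<Omega> - {1}. coeff (P z) 0) = (\<Prod>z \<in> ?\<Omega> - {1}. leval z (ihara_poly X \<alpha> vs))"
    unfolding P_def using n
    by (intro prod.cong refl coeff_0_det_twisted_laplacian) (auto simp: power_0_left)
  finally show "of_nat (n * kappa (cyclic_cover X \<alpha> n) (cyclic_cover_bar X bar \<alpha> n)) =
    of_nat (kappa (cyclic_cover X \<alpha> 1) (cyclic_cover_bar X bar \<alpha> 1)) *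
      (\<Prod>z \<in> ?\<Omega> - {1}. leval z (ihara_poly X \<alpha> vs))" unfolding P1 .
qed

section \<open>Algebraic numbers\<close>

interpretation rat_vs: vector_space "\<lambda>(q :: rat) (x :: 'a :: field_char_0). of_rat q * x"
  by unfold_locales (auto simp: algebra_simps of_rat_add of_rat_mult)

text \<open>A repeated power is itself a polynomial equation. Otherwise \<open>Suc (card B)\<close>
  distinct powers lie in the span of \<open>card B\<close> vectors and are dependent over the
  rationals; that they are distinct lets the relation be read as a polynomial.\<close>

lemma algebraic_if_powers_in_span:
  fixes z :: "'a :: field_char_0"
  assumes fin: "finite B" and sp: "\<And>i. z ^ i \<in> rat_vs.span B"
  shows "z \<in> algebraic_elements \<rat>"
proof (cases "inj (\<lambda>i. z ^ i)")
  case False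
  then obtain i j where ij: "i < j" "z ^ i = z ^ j"
    unfolding inj_def by (metis linorder_neqE_nat)
  define f :: "'a poly" where "f = monom 1 i - monom 1 j"
  have "coeff f j = - 1" using ij by (simp add: f_def)
  hence "f \<noteq> 0" by auto
  moreover have "coeff f n \<in> \<rat>" for n by (auto simp: f_def)
  moreover have "poly f z = 0" using ij by (simp add: f_def poly_monom)
  ultimately show ?thesis unfolding algebraic_elements_def by blast
next
  case True
  let ?S = "(\<lambda>i. z ^ i) ` {..card B}"
  have "card ?S = Suc (card B)" using True by (subst card_image) (auto intro: inj_on_subset)
  moreover have "?S \<subseteq> rat_vs.span B" using sp by auto
  ultimately have "rat_vs.dependent ?S"
    using rat_vs.independent_span_bound[OF fin, of ?S] by auto
  then obtain u where u: "\<exists>v \<in> ?S. u v \<noteq> 0" "(\<Sum>v \<in> ?S. of_rat (u v) * v) = 0"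
    unfolding rat_vs.dependent_finite[OF finite_imageI[OF finite_atMost]] by blast
  define f :: "'a poly" where "f = (\<Sum>i\<le>card B. monom (of_rat (u (z ^ i))) i)"
  have coeff: "coeff f n = (if n \<le> card B then of_rat (u (z ^ n)) else 0)" for n
    by (simp add: f_def coeff_sum)
  have "poly f z = (\<Sum>i\<le>card B. of_rat (u (z ^ i)) * z ^ i)"
    by (simp add: f_def poly_sum poly_monom)
  also have "\<dots> = (\<Sum>v \<in> ?S. of_rat (u v) * v)"
    using True by (subst sum.reindex) (auto intro: inj_on_subset)
  finally have "poly f z = 0" using u by simp
  moreover obtain i where "i \<le> card B" "u (z ^ i) \<noteq> 0" using u by auto
  hence "coeff f i \<noteq> 0" by (simp add: coeff)
  hence "f \<noteq> 0" by auto
  moreover have "coeff f n \<in> \<rat>" for n by (simp add: coeff)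
  ultimately show ?thesis unfolding algebraic_elements_def by blast
qed

lemma algebraic_reduction:
  fixes x :: "'a :: field_char_0"
  assumes "x \<in> algebraic_elements \<rat>"
  obtains n c where "\<And>i. c i \<in> \<rat>" "x ^ n = (\<Sum>i<n. c i * x ^ i)"
proof -
  obtain f where f: "f \<noteq> 0" "\<And>i. coeff f i \<in> \<rat>" "poly f x = 0"
    using assms unfolding algebraic_elements_def by blast
  define c where "c i = - coeff f i / lead_coeff f" for i
  have "0 = (\<Sum>i<degree f. coeff f i * x ^ i) + lead_coeff f * x ^ degree f"
    using f(3) unfolding poly_altdef by (simp flip: lessThan_Suc_atMost)
  hence "x ^ degree f * lead_coeff f = - (\<Sum>i<degree f. coeff f i * x ^ i)"
    by (simp add: add_eq_0_iff mult.commute)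
  hence "x ^ degree f = (- (\<Sum>i<degree f. coeff f i * x ^ i)) / lead_coeff f"
    using f(1) by (subst nonzero_eq_divide_eq) auto
  also have "\<dots> = (\<Sum>i<degree f. c i * x ^ i)"
    by (simp add: c_def sum_divide_distrib flip: sum_negf)
  finally show thesis using that[of c] f(2) by (simp add: c_def)
qed

text \<open>The rational span of the monomials in two algebraic numbers is stable under
  multiplication with either of them.\<close>

lemma algebraic_closed:
  fixes x y :: "'a :: field_char_0"
  assumes "x \<in> algebraic_elements \<rat>" "y \<in> algebraic_elements \<rat>"
  shows "x + y \<in> algebraic_elements \<rat>" "x * y \<in> algebraic_elements \<rat>"
proof -
  obtain m c where c: "\<And>i. c i \<in> \<rat>" "x ^ m = (\<Sum>i<m. c i * x ^ i)"
    using algebraic_reduction[OF assms(1)] by blast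
  obtain n d where d: "\<And>i. d i \<in> \<rat>" "y ^ n = (\<Sum>i<n. d i * y ^ i)"
    using algebraic_reduction[OF assms(2)] by blast
  define B where "B = (\<lambda>(i, j). x ^ i * y ^ j) ` ({..<m} \<times> {..<n})"
  let ?W = "rat_vs.span B"
  have scale: "q * w \<in> ?W" if "q \<in> \<rat>" "w \<in> ?W" for q w
    using that by (auto elim!: Rats_cases intro: rat_vs.span_scale)
  have base: "x ^ i * y ^ j \<in> ?W" if "i < m" "j < n" for i j
    by (rule rat_vs.span_base) (use that in \<open>auto simp: B_def\<close>)
  have stable: "t * w \<in> ?W" if "w \<in> ?W" "\<And>b. b \<in> B \<Longrightarrow> t * b \<in> ?W" for t w
    using that(1)
  proof (induction w rule: rat_vs.span_induct_alt)
    case base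
    show ?case by (simp add: rat_vs.span_zero)
  next
    case (step q b w)
    have "t * (of_rat q * b + w) = of_rat q * (t * b) + t * w" by (simp add: algebra_simps)
    thus ?case using that(2)[OF step(1)] step(2) by (simp add: rat_vs.span_add rat_vs.span_scale)
  qed
  have xW: "x * w \<in> ?W" if "w \<in> ?W" for w
  proof (rule stable[OF that])
    fix b assume "b \<in> B"
    then obtain i j where b: "b = x ^ i * y ^ j" "i < m" "j < n" by (auto simp: B_def)
    show "x * b \<in> ?W"
    proof (cases "Suc i < m")
      case True
      thus ?thesis using base[OF True b(3)] b by (simp add: mult.assoc)
    next
      case False
      hence "m = Suc i" using b by simp
      hence "x * b = x ^ m * y ^ j" using b by simp
      also have "\<dots> = (\<Sum>i<m. c i * (x ^ i * y ^ j))"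
        unfolding c(2) sum_distrib_right by (simp add: mult.assoc)
      finally show ?thesis using c(1) base b scale by (auto intro!: rat_vs.span_sum)
    qed
  qed
  have yW: "y * w \<in> ?W" if "w \<in> ?W" for w
  proof (rule stable[OF that])
    fix b assume "b \<in> B"
    then obtain i j where b: "b = x ^ i * y ^ j" "i < m" "j < n" by (auto simp: B_def)
    show "y * b \<in> ?W"
    proof (cases "Suc j < n")
      case True
      thus ?thesis using base[OF b(2) True] b by (simp add: mult_ac)
    next
      case False
      hence "n = Suc j" using b by simp
      hence "y * b = x ^ i * y ^ n" using b by (simp add: mult_ac)
      also have "\<dots> = (\<Sum>j<n. d j * (x ^ i * y ^ j))"
        unfolding d(2) sum_distrib_left by (simp add: mult_ac)
      finally show ?thesis using d(1) base b scale by (auto intro!: rat_vs.span_sum)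
    qed
  qed
  have one: "1 \<in> ?W"
  \<comment> \<open>The reductions do not record that the exponents are positive; exponent 0 would
    read 1 = 0.\<close>
  proof (cases "m = 0 \<or> n = 0")
    case True
    hence "(1 :: 'a) = 0" using c(2) d(2) by auto
    thus ?thesis by simp
  next
    case False
    thus ?thesis using base[of 0 0] by simp
  qed
  have "(x + y) ^ k \<in> ?W" for k
    by (induction k) (use one xW yW in \<open>auto simp: distrib_right intro: rat_vs.span_add\<close>)
  moreover have "(x * y) ^ k \<in> ?W" for k
    by (induction k) (use one xW yW in \<open>auto simp: mult.assoc\<close>)
  moreover have "finite B" by (simp add: B_def)
  ultimately show "x + y \<in> algebraic_elements \<rat>" "x * y \<in> algebraic_elements \<rat>"
    using algebraic_if_powers_in_span by blast+
qed

lemma Rats_algebraic: "x \<in> \<rat> \<Longrightarrow> x \<in> algebraic_elements \<rat>"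
proof -
  assume "x \<in> \<rat>"
  moreover have "coeff [:- x, 1:] i \<in> \<rat>" if "x \<in> \<rat>" for i
    using that by (auto simp: coeff_pCons split: nat.split)
  ultimately show ?thesis unfolding algebraic_elements_def by (auto intro!: exI[of _ "[:- x, 1:]"])
qed

text \<open>By Horner's scheme the coefficients of the quotient are values at \<open>c\<close> of
  tails of \<open>f\<close>, hence built from algebraic numbers by sums and products.\<close>

lemma coeff_synthetic_div_algebraic:
  fixes f :: "'a :: field_char_0 poly"
  assumes "\<And>i. coeff f i \<in> algebraic_elements \<rat>" "c \<in> algebraic_elements \<rat>"
  shows "coeff (synthetic_div f c) i \<in> algebraic_elements \<rat>"
  using assms(1)
proof (induction f arbitrary: i)
  case 0
  show ?case by (simp add: Rats_algebraic)
next
  case (pCons a f)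
  have f: "coeff f j \<in> algebraic_elements \<rat>" for j using pCons.prems[of "Suc j"] by simp
  have "poly f c \<in> algebraic_elements \<rat>"
    using f
  proof (induction f)
    case 0
    show ?case by (simp add: Rats_algebraic)
  next
    case (pCons b f)
    have "coeff f j \<in> algebraic_elements \<rat>" for j using pCons.prems[of "Suc j"] by simp
    thus ?case using pCons.IH pCons.prems[of 0] assms(2) by (simp add: algebraic_closed)
  qed
  thus ?case using pCons.IH[OF f] by (auto simp: coeff_pCons synthetic_div_pCons split: nat.split)
qed

lemma algebraic_elements_mono: "F \<subseteq> K \<Longrightarrow> algebraic_elements F \<subseteq> algebraic_elements K"
  unfolding algebraic_elements_def by blast

section \<open>Splitting of rational polynomials in the p-adic field\<close>

context padic_complex_field
begin

text \<open>The induction runs over divisors of \<open>f\<close> with coefficients algebraic over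
  the rationals. A root of such a divisor is a root of \<open>f\<close>, hence algebraic over the
  rationals without any appeal to transitivity, and the quotient is again a divisor of this
  kind.\<close>

lemma rational_poly_splits:
  fixes f :: "'k poly"
  assumes f: "f \<noteq> 0" "\<And>i. coeff f i \<in> \<rat>"
  shows "f = Polynomial.smult (lead_coeff f) (\<Prod>\<beta> \<in># proots f. [:- \<beta>, 1:])"
proof -
  let ?Q = "algebraic_elements (\<rat> :: 'k set)" and ?K = "metric.mtopology closure_of (\<rat> :: 'k set)"
  have "\<rat> \<subseteq> ?K" by (rule closure_of_subset) simp
  hence sub: "?Q \<subseteq> algebraic_elements ?K" by (rule algebraic_elements_mono)
  have *: "g = Polynomial.smult (lead_coeff g) (\<Prod>\<beta> \<in># proots g. [:- \<beta>, 1:])"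
    if "g dvd f" "g \<noteq> 0" "\<And>i. coeff g i \<in> ?Q" for g
    using that
  proof (induction "degree g" arbitrary: g)
    case 0
    then obtain c where "g = [:c:]" by (metis degree_eq_zeroE)
    thus ?case by simp
  next
    case (Suc k)
    obtain x where x: "poly g x = 0"
      using alg_closure_closed Suc sub unfolding alg_closed_subfield_def
      by (metis subsetD zero_less_Suc)
    have "poly f x = 0" using x Suc.prems(1) by (auto simp: dvd_def)
    hence xQ: "x \<in> ?Q" using f unfolding algebraic_elements_def by blast
    define h where "h = synthetic_div g x"
    have g: "g = [:- x, 1:] * h"
      using synthetic_div_correct'[of x g] x by (simp add: h_def)
    have h0: "h \<noteq> 0" using g Suc.prems by auto
    have deg: "degree g = Suc (degree h)" unfolding g using h0 by (subst degree_mult_eq) auto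
    have "h dvd f" using Suc.prems(1) g by (metis dvd_mult_right)
    moreover have "coeff h i \<in> ?Q" for i
      unfolding h_def by (rule coeff_synthetic_div_algebraic[OF Suc.prems(3) xQ])
    moreover have "k = degree h" using Suc.hyps(2) deg by simp
    ultimately have h: "h = Polynomial.smult (lead_coeff h) (\<Prod>\<beta> \<in># proots h. [:- \<beta>, 1:])"
      using h0 Suc.hyps(1) by blast
    have lead: "lead_coeff g = lead_coeff h"
      using arg_cong[OF g, of lead_coeff] by (simp only: lead_coeff_mult) simp
    have roots: "proots g = add_mset x (proots h)"
      unfolding g using h0 by (subst proots_mult) auto
    have "Polynomial.smult (lead_coeff g) (\<Prod>\<beta> \<in># proots g. [:- \<beta>, 1:]) =
        [:- x, 1:] * Polynomial.smult (lead_coeff h) (\<Prod>\<beta> \<in># proots h. [:- \<beta>, 1:])"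
      by (simp only: lead roots prod_mset.add_mset image_mset_add_mset mult_smult_right)
    also have "\<dots> = g" using g h by simp
    finally show ?case ..
  qed
  show ?thesis by (rule *) (use f in \<open>auto intro: Rats_algebraic\<close>)
qed

end

section \<open>Powers in non-archimedean fields\<close>

context nonarch_abs
begin

lemma v_0 [simp]: "v 0 = 0"
  by (simp add: v_eq_0_iff)

lemma v_1 [simp]: "v 1 = 1"
  using v_mult[of 1 1] v_eq_0_iff[of 1] by simp

lemma v_pos: "x \<noteq> 0 \<Longrightarrow> v x > 0"
  using v_nonneg[of x] v_eq_0_iff[of x] by simp

lemma v_power: "v (x ^ n) = v x ^ n"
  by (induction n) (auto simp: v_mult)

lemma v_prod: "v (\<Prod>i \<in> A. f i) = (\<Prod>i \<in> A. v (f i))"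
  by (induction A rule: infinite_finite_induct) (auto simp: v_mult)

lemma v_prod_mset: "v (\<Prod>i \<in># A. f i) = (\<Prod>i \<in># A. v (f i))"
  by (induction A) (auto simp: v_mult)

lemma v_diff_commute: "v (x - y) = v (y - x)"
  using v_minus[of "x - y"] by simp

lemma v_add_less: "v x < c \<Longrightarrow> v y < c \<Longrightarrow> v (x + y) < c"
  using v_ultrametric[of x y] by simp

lemma v_diff_less: "v x < c \<Longrightarrow> v y < c \<Longrightarrow> v (x - y) < c"
  using v_add_less[of x c "- y"] by (simp add: v_minus)

lemma v_mult_less:
  assumes "v x \<le> 1" "v y < c"
  shows "v (x * y) < c"
proof -
  have "v (x * y) \<le> v y" unfolding v_mult using assms(1) by (intro mult_left_le_one_le v_nonneg)
  thus ?thesis using assms(2) by simp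
qed

lemma v_sum_le: "(\<And>i. i \<in> A \<Longrightarrow> v (f i) \<le> c) \<Longrightarrow> 0 \<le> c \<Longrightarrow> v (\<Sum>i \<in> A. f i) \<le> c"
proof (induction A rule: infinite_finite_induct)
  case (insert a A)
  thus ?case using v_ultrametric[of "f a" "sum f A"] by fastforce
qed auto

lemma v_sum_less: "(\<And>i. i \<in> A \<Longrightarrow> v (f i) < c) \<Longrightarrow> 0 < c \<Longrightarrow> v (\<Sum>i \<in> A. f i) < c"
proof (induction A rule: infinite_finite_induct)
  case (insert a A)
  thus ?case by (auto intro!: v_add_less)
qed auto

lemma v_add_dominant:
  assumes "v y < v x"
  shows "v (x + y) = v x"
proof (rule antisym)
  show "v (x + y) \<le> v x" using v_ultrametric[of x y] assms by simp
  have "v x \<le> max (v (x + y)) (v y)" using v_ultrametric[of "x + y" "- y"] by (simp add: v_minus)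
  thus "v x \<le> v (x + y)" using assms by simp
qed

lemma v_of_nat_le: "v (of_nat n) \<le> 1"
proof (induction n)
  case (Suc n)
  thus ?case using v_ultrametric[of 1 "of_nat n"] by simp
qed simp

lemma v_of_int_le: "v (of_int a) \<le> 1"
  by (cases a) (use v_of_nat_le v_minus in \<open>auto simp del: of_nat_Suc\<close>)

lemma v_power_minus_1_le:
  assumes "v (x - 1) \<le> 1"
  shows "v (x ^ k - 1) \<le> v (x - 1)"
proof -
  have "v x \<le> 1" using v_ultrametric[of "x - 1" 1] assms by simp
  hence "v (\<Sum>j<k. x ^ j) \<le> 1"
    by (intro v_sum_le) (auto simp: v_power v_nonneg power_le_one)
  thus ?thesis
    by (simp add: power_diff_1_eq v_mult v_nonneg mult_left_le)
qed

text \<open>Both estimates come from \<open>x ^ k - 1 = (x - 1) * (k + (\<Sum>j<k. x ^ j - 1))\<close>.\<close>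

lemma v_power_minus_1:
  assumes "v (x - 1) \<le> 1"
  shows "v (x ^ k - 1) \<le> v (x - 1) * max (v (of_nat k)) (v (x - 1))"
    and "v (x - 1) < v (of_nat k) \<Longrightarrow> v (x ^ k - 1) = v (x - 1) * v (of_nat k)"
proof -
  define s where "s = (\<Sum>j<k. x ^ j - 1)"
  have s: "v s \<le> v (x - 1)"
    unfolding s_def using v_power_minus_1_le[OF assms] by (intro v_sum_le) (auto simp: v_nonneg)
  have "of_nat k + s = (\<Sum>j<k. x ^ j)"
    by (simp add: s_def sum_subtractf)
  hence *: "x ^ k - 1 = (x - 1) * (of_nat k + s)"
    by (simp add: power_diff_1_eq)
  have "v (of_nat k + s) \<le> max (v (of_nat k)) (v (x - 1))"
    using v_ultrametric[of "of_nat k" s] s by simp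
  thus "v (x ^ k - 1) \<le> v (x - 1) * max (v (of_nat k)) (v (x - 1))"
    unfolding * v_mult by (intro mult_left_mono) (auto simp: v_nonneg)
  show "v (x ^ k - 1) = v (x - 1) * v (of_nat k)" if "v (x - 1) < v (of_nat k)"
    unfolding * v_mult using v_add_dominant[of s "of_nat k"] s that by simp
qed

text \<open>A new coefficient is a difference of two terms, so for the lower bound an index is
  needed at which one of them strictly dominates.\<close>

lemma gauss_norm:
  fixes R :: "'k multiset"
  defines "f \<equiv> \<Prod>\<beta> \<in># R. [:- \<beta>, 1:]" and "M \<equiv> \<Prod>\<beta> \<in># R. max 1 (v \<beta>)"
  shows "(\<forall>i. v (coeff f i) \<le> M) \<and> (\<exists>i. v (coeff f i) = M)"
  unfolding f_def M_def
proof (induction R)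
  case empty
  have "v (coeff 1 i) \<le> 1" for i :: nat by (cases i) auto
  moreover have "v (coeff 1 0) = 1" by simp
  ultimately show ?case by auto
next
  case (add \<beta> R)
  define f where "f = (\<Prod>\<beta> \<in># R. [:- \<beta>, 1:])"
  define M where "M = (\<Prod>\<beta> \<in># R. max 1 (v \<beta>))"
  have le: "v (coeff f i) \<le> M" for i using add by (simp add: f_def M_def)
  have ex: "\<exists>i. v (coeff f i) = M" using add by (simp add: f_def M_def)
  have M: "M > 0" unfolding M_def by (induction R) (auto simp: less_max_iff_disj)
  define g where "g = [:- \<beta>, 1:] * f"
  have coeff: "coeff g i = (if i = 0 then 0 else coeff f (i - 1)) - \<beta> * coeff f i" for i
    by (simp add: g_def coeff_pCons split: nat.split)
  have shift: "v (if i = 0 then 0 else coeff f (i - 1)) \<le> M" for i using le M by auto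
  have bound: "v (\<beta> * coeff f i) \<le> v \<beta> * M" for i
    using le by (simp add: v_mult mult_left_mono v_nonneg)
  have "v (coeff g i) \<le> max 1 (v \<beta>) * M" for i
  proof -
    have "v (coeff g i) \<le> max M (v \<beta> * M)"
      unfolding coeff
      using v_ultrametric[of "if i = 0 then 0 else coeff f (i - 1)" "- (\<beta> * coeff f i)"] shift[of i] bound[of i]
      by (simp add: v_minus)
    also have "\<dots> = max 1 (v \<beta>) * M" using M by (simp add: max_mult_distrib_right)
    finally show ?thesis .
  qed
  moreover have "\<exists>i. v (coeff g i) = max 1 (v \<beta>) * M"
  proof (cases "v \<beta> \<le> 1")
    case True
    \<comment> \<open>At the last index of maximal absolute value the following coefficient is
      strictly smaller, so nothing cancels at \<open>Suc i\<close>.\<close>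
    define i where "i = Max {i. v (coeff f i) = M}"
    have "{i. v (coeff f i) = M} \<subseteq> {..degree f}"
      using M by (auto intro!: le_degree)
    hence fin: "finite {i. v (coeff f i) = M}" using finite_subset by blast
    have i: "v (coeff f i) = M" using Max_in[OF fin] ex unfolding i_def by auto
    have "v (coeff f (Suc i)) \<noteq> M" using Max_ge[OF fin, of "Suc i"] unfolding i_def by auto
    hence "v (coeff f (Suc i)) < M" using le[of "Suc i"] by simp
    hence "v (\<beta> * coeff f (Suc i)) < M" using True by (intro v_mult_less)
    hence "v (coeff g (Suc i)) = M"
      unfolding coeff using v_add_dominant[of "- (\<beta> * coeff f (Suc i))" "coeff f i"] i
      by (simp add: v_minus)
    thus ?thesis using True by (auto simp: max_def)
  next
    case False
    obtain i where i: "v (coeff f i) = M" using ex by blast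
    have "v (coeff g i) = v (- (\<beta> * coeff f i) + (if i = 0 then 0 else coeff f (i - 1)))"
      by (simp add: coeff)
    also have "\<dots> = v (- (\<beta> * coeff f i))"
    proof (rule v_add_dominant)
      have "M < v \<beta> * M" using False M by simp
      thus "v (if i = 0 then 0 else coeff f (i - 1)) < v (- (\<beta> * coeff f i))"
        using shift[of i] by (simp add: v_minus v_mult i)
    qed
    also have "\<dots> = max 1 (v \<beta>) * M" using False by (simp add: v_minus v_mult i)
    finally show ?thesis by blast
  qed
  ultimately show ?case by (simp add: g_def f_def M_def)
qed

end

section \<open>Absolute values of integers and of powers minus 1\<close>

context padic_complex_field
begin

lemma p_gt_1: "real p > 1"
  using prime_p prime_gt_1_nat by simp

lemma v_of_int_dvd:
  assumes "int p dvd a"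
  shows "v (of_int a) < 1"
proof -
  obtain b where "a = int p * b" using assms by blast
  hence "v (of_int a) = v (of_int b) / real p" by (simp add: v_mult abs_p)
  also have "\<dots> \<le> 1 / real p" using v_of_int_le[of b] p_gt_1 by (simp add: divide_right_mono)
  also have "\<dots> < 1" using p_gt_1 by simp
  finally show ?thesis .
qed

text \<open>Otherwise a Bezout relation between \<open>p\<close> and \<open>a\<close> would write 1
  as a sum of two elements of absolute value less than 1.\<close>

lemma v_of_int_not_dvd:
  assumes "\<not> int p dvd a"
  shows "v (of_int a) = 1"
proof (rule ccontr)
  assume "v (of_int a) \<noteq> 1"
  hence a: "v (of_int a) < 1" using v_of_int_le[of a] by simp
  have "coprime (int p) a" using assms prime_p by (simp add: prime_imp_coprime)
  then obtain x y where "x * int p + y * a = 1"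
    by (metis bezout_int coprime_iff_gcd_eq_1)
  hence "1 = of_int x * of_int (int p) + of_int y * (of_int a :: 'k)"
    by (metis of_int_1 of_int_add of_int_mult)
  moreover have "v (of_int x * of_int (int p)) < 1"
    using v_of_int_dvd[of "x * int p"] by simp
  moreover have "v (of_int y * of_int a) < 1"
    using a v_of_int_le by (intro v_mult_less)
  ultimately have "v (1 :: 'k) < 1" using v_add_less by metis
  thus False by simp
qed

lemma v_of_nat:
  assumes "n > 0"
  shows "v (of_nat n) = (1 / real p) ^ multiplicity p n"
proof -
  obtain u where u: "n = p ^ multiplicity p n * u" "\<not> p dvd u"
    using multiplicity_decompose'[of n p] assms prime_p by (metis not_is_unit_0 not_prime_unit neq0_conv)
  have "v (of_nat u) = 1" using v_of_int_not_dvd[of "int u"] u(2) by simp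
  moreover have "v (of_nat n) = v (of_nat p) ^ multiplicity p n * v (of_nat u)"
    by (subst u(1)) (simp add: v_mult v_power)
  ultimately show ?thesis by (simp add: abs_p)
qed

lemma v_of_int_power:
  assumes "a \<noteq> 0"
  obtains k where "v (of_int a) = (1 / real p) ^ k"
proof -
  have "v (of_int a) = v (of_nat (nat \<bar>a\<bar>))" by (cases "a \<ge> 0") (auto simp: v_minus)
  thus thesis using v_of_nat[of "nat \<bar>a\<bar>"] assms that by simp
qed

text \<open>The part of \<open>k\<close> prime to \<open>p\<close> does not change the absolute
  value, so only the exponent \<open>s\<close> of \<open>p\<close> in \<open>k\<close> matters.
  Taking \<open>p\<close>-th powers first shrinks the distance to 1 geometrically and, once it is
  below \<open>1 / p\<close>, divides it by exactly \<open>p\<close>, just as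
  \<open>v (of_nat k)\<close> is divided. The quotient is then constant in \<open>s\<close>.\<close>

lemma one_unit_power:
  assumes y: "v (\<gamma> - 1) < 1" and nr: "\<And>k. k > 0 \<Longrightarrow> \<gamma> ^ k \<noteq> 1"
  shows "finite ((\<lambda>k. v (\<gamma> ^ k - 1) / v (of_nat k)) ` {1..})"
proof -
  define Y where "Y s = v (\<gamma> ^ (p ^ s) - 1)" for s
  have Y1: "Y s < 1" for s
    using v_power_minus_1_le[of \<gamma> "p ^ s"] y unfolding Y_def by simp
  have YSuc: "\<gamma> ^ (p ^ Suc s) = (\<gamma> ^ (p ^ s)) ^ p" for s
    by (simp flip: power_mult) (simp add: mult.commute)
  \<comment> \<open>The contraction rate: each \<open>p\<close>-th power multiplies the distance by
    at most \<open>max (v (of_nat p)) (Y s)\<close>, and \<open>Y s\<close> never exceeds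
    \<open>v (\<gamma> - 1)\<close>.\<close>
  define q where "q = max (1 / real p) (v (\<gamma> - 1))"
  have q: "0 \<le> q" "q < 1" using y p_gt_1 v_nonneg by (auto simp: q_def le_max_iff_disj)
  have decay: "Y s \<le> q ^ s" for s
  proof (induction s)
    case 0
    show ?case using Y1[of 0] by simp
  next
    case (Suc s)
    have "Y (Suc s) \<le> Y s * max (v (of_nat p)) (Y s)"
      using v_power_minus_1(1)[of "\<gamma> ^ (p ^ s)" p] Y1[of s] unfolding Y_def YSuc by simp
    also have "\<dots> \<le> Y s * q"
      using v_power_minus_1_le[of \<gamma> "p ^ s"] y
      by (intro mult_left_mono) (auto simp: Y_def q_def abs_p v_nonneg)
    also have "\<dots> \<le> q ^ s * q" using Suc q by (intro mult_right_mono) auto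
    finally show ?case by (simp add: mult.commute)
  qed
  obtain s0 where s0: "q ^ s0 < 1 / real p"
    using real_arch_pow_inv[of "1 / real p" q] q p_gt_1 by auto
  have stable: "Y (s0 + t) = Y s0 * (1 / real p) ^ t \<and> Y (s0 + t) < 1 / real p" for t
  proof (induction t)
    case 0
    show ?case using decay[of s0] s0 by simp
  next
    case (Suc t)
    have "Y (s0 + Suc t) = Y (s0 + t) * (1 / real p)"
      using v_power_minus_1(2)[of "\<gamma> ^ (p ^ (s0 + t))" p] Suc Y1[of "s0 + t"]
      unfolding Y_def add_Suc_right YSuc by (simp add: abs_p)
    moreover have "Y (s0 + t) * (1 / real p) \<le> Y (s0 + t)"
      using p_gt_1 v_nonneg by (intro mult_left_le) (auto simp: Y_def)
    ultimately show ?case using Suc by simp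
  qed
  have "v (\<gamma> ^ k - 1) / v (of_nat k) \<in> (\<lambda>s. Y s / (1 / real p) ^ s) ` {..s0}" if k: "k \<ge> 1" for k
  proof -
    define s where "s = multiplicity p k"
    obtain u where u: "k = p ^ s * u" "\<not> p dvd u"
      using multiplicity_decompose'[of k p] k prime_p unfolding s_def
      by (metis not_is_unit_0 not_one_le_zero not_prime_unit)
    have "v (of_nat u) = 1" using v_of_int_not_dvd[of "int u"] u(2) by simp
    hence "v (\<gamma> ^ k - 1) = Y s"
      using v_power_minus_1(2)[of "\<gamma> ^ (p ^ s)" u] Y1[of s] unfolding u(1) power_mult Y_def by simp
    hence *: "v (\<gamma> ^ k - 1) / v (of_nat k) = Y s / (1 / real p) ^ s"
      using k by (simp add: v_of_nat s_def)
    show ?thesis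
    proof (cases "s \<le> s0")
      case False
      then obtain t where t: "s = s0 + t" by (metis le_add_diff_inverse nat_le_linear)
      have "Y s / (1 / real p) ^ s = Y s0 / (1 / real p) ^ s0"
        unfolding t using stable[of t] p_gt_1 by (simp add: power_add field_simps)
      thus ?thesis using * by auto
    qed (use * in auto)
  qed
  hence "(\<lambda>k. v (\<gamma> ^ k - 1) / v (of_nat k)) ` {1..} \<subseteq> (\<lambda>s. Y s / (1 / real p) ^ s) ` {..s0}" by auto
  thus ?thesis using finite_subset by blast
qed

lemma exists_unit_coeff:
  fixes J :: "int poly"
  assumes "J \<noteq> 0"
  shows "\<exists>i. \<not> int p dvd coeff (primitive_part J) i"
proof (rule ccontr)
  assume "\<not> ?thesis"
  hence "[:int p:] dvd primitive_part J" by (simp add: const_poly_dvd_iff)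
  hence "int p dvd content (primitive_part J)" by (simp add: const_poly_dvd_iff_dvd_content)
  thus False using assms prime_p by (simp add: content_primitive_part)
qed

text \<open>The reductions of the powers of \<open>\<beta>\<close> lie in a finite-dimensional space over
  the prime field, so two of them agree.\<close>

lemma unit_power_near_1:
  fixes J :: "int poly"
  assumes J: "J \<noteq> 0" "poly (map_poly of_int J) \<beta> = 0" and \<beta>: "v \<beta> = 1"
  shows "\<exists>m > 0. v (\<beta> ^ m - 1) < 1"
proof -
  \<comment> \<open>Dividing by the content makes the reduction modulo \<open>p\<close>
    nonzero.\<close>
  define f where "f = primitive_part J"
  have "of_int (content J) * poly (map_poly of_int f) \<beta> = 0"
  proof -
    have "map_poly of_int J = Polynomial.smult (of_int (content J)) (map_poly of_int f :: 'k poly)"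
    proof (rule poly_eqI)
      fix n
      have "coeff J n = content J * coeff f n"
        unfolding f_def by (metis Polynomial.coeff_smult content_times_primitive_part)
      thus "coeff (map_poly of_int J) n = coeff (Polynomial.smult (of_int (content J)) (map_poly of_int f)) n"
        by (simp add: coeff_map_poly)
    qed
    thus ?thesis using J by simp
  qed
  hence root: "poly (map_poly of_int f) \<beta> = 0" using J by simp
  define I where "I = {i. \<not> int p dvd coeff f i}"
  have "I \<subseteq> {..degree f}" by (auto simp: I_def intro!: le_degree)
  hence finI: "finite I" using finite_subset by blast
  have "I \<noteq> {}" using exists_unit_coeff[OF J(1)] by (auto simp: I_def f_def)
  \<comment> \<open>The degree of the reduction of \<open>f\<close> modulo \<open>p\<close>.\<close>
  define r where "r = Max I"
  have r: "\<not> int p dvd coeff f r" "r \<le> degree f"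
    using Max_in[OF finI \<open>I \<noteq> {}\<close>] \<open>I \<subseteq> _\<close> by (auto simp: r_def I_def)
  have above: "int p dvd coeff f i" if "i > r" for i
    using Max_ge[OF finI, of i] that by (auto simp: r_def I_def)
  have vpow: "v (\<beta> ^ i) = 1" for i by (simp add: v_power \<beta>)
  have small: "v (of_int a * \<beta> ^ i) < 1" if "int p dvd a" for a i
    using v_of_int_dvd[OF that] by (simp add: v_mult vpow)
  have low: "v (\<Sum>i\<le>r. of_int (coeff f i) * \<beta> ^ i) < 1"
  proof -
    have "0 = (\<Sum>i\<le>degree f. of_int (coeff f i) * \<beta> ^ i)"
      using root by (simp add: poly_altdef coeff_map_poly degree_map_poly)
    also have "{..degree f} = {..r} \<union> {r<..degree f}" using r(2) by auto
    also have "(\<Sum>i \<in> \<dots>. of_int (coeff f i) * \<beta> ^ i) =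
      (\<Sum>i\<le>r. of_int (coeff f i) * \<beta> ^ i) + (\<Sum>i \<in> {r<..degree f}. of_int (coeff f i) * \<beta> ^ i)"
      by (rule sum.union_disjoint) auto
    finally have "(\<Sum>i\<le>r. of_int (coeff f i) * \<beta> ^ i) = - (\<Sum>i \<in> {r<..degree f}. of_int (coeff f i) * \<beta> ^ i)"
      by (simp add: eq_neg_iff_add_eq_0)
    moreover have "v (\<Sum>i \<in> {r<..degree f}. of_int (coeff f i) * \<beta> ^ i) < 1"
      by (intro v_sum_less small above) auto
    ultimately show ?thesis by (simp add: v_minus)
  qed
  have "coprime (coeff f r) (int p)"
    using r(1) prime_p by (simp add: prime_imp_coprime coprime_commute)
  \<comment> \<open>\<open>b\<close> inverts the leading coefficient of the reduction, which turns
    the equation for \<open>\<beta>\<close> into a monic one up to terms of absolute value less than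
    1.\<close>
  then obtain b y where "b * coeff f r + y * int p = 1"
    by (metis bezout_int coprime_iff_gcd_eq_1)
  hence "1 - b * coeff f r = int p * y" by (simp add: algebra_simps)
  hence b: "int p dvd 1 - b * coeff f r" by (rule dvdI)
  define a where "a i = b * coeff f i" for i
  have rel: "v (\<beta> ^ r + (\<Sum>i<r. of_int (a i) * \<beta> ^ i)) < 1"
  proof -
    have eq: "\<beta> ^ r + (\<Sum>i<r. of_int (a i) * \<beta> ^ i) =
      of_int b * (\<Sum>i\<le>r. of_int (coeff f i) * \<beta> ^ i) + of_int (1 - b * coeff f r) * \<beta> ^ r"
      by (simp add: a_def sum_distrib_left algebra_simps flip: lessThan_Suc_atMost)
    have "v (of_int b * (\<Sum>i\<le>r. of_int (coeff f i) * \<beta> ^ i)) < 1"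
      using low v_of_int_le by (intro v_mult_less)
    thus ?thesis unfolding eq using small[OF b] by (rule v_add_less)
  qed
  have "r \<noteq> 0"
  proof
    assume "r = 0"
    with rel show False by simp
  qed
  then obtain k where k: "r = Suc k" using not0_implies_Suc by blast
  have ex: "\<exists>c :: nat \<Rightarrow> int. v (\<beta> ^ N - (\<Sum>i<r. of_int (c i) * \<beta> ^ i)) < 1" for N
  proof (induction N)
    case 0
    show ?case unfolding k sum.lessThan_Suc_shift
      by (intro exI[of _ "\<lambda>i. if i = 0 then 1 else 0"]) simp
  next
    case (Suc N)
    then obtain c where c: "v (\<beta> ^ N - (\<Sum>i<r. of_int (c i :: int) * \<beta> ^ i)) < 1" by blast
    \<comment> \<open>Multiplication by \<open>\<beta>\<close> shifts the coefficients up, and the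
      power \<open>\<beta> ^ r\<close> that arises is replaced by means of the monic
      relation.\<close>
    define c' where "c' i = (if i = 0 then 0 else c (i - 1)) - c k * a i" for i
    have "(\<Sum>i<r. of_int (c' i) * \<beta> ^ i) =
      (\<Sum>i<r. of_int (if i = 0 then 0 else c (i - 1)) * \<beta> ^ i) - of_int (c k) * (\<Sum>i<r. of_int (a i) * \<beta> ^ i)"
      by (simp only: c'_def of_int_diff of_int_mult left_diff_distrib sum_subtractf sum_distrib_left mult.assoc)
    also have "(\<Sum>i<r. of_int (if i = 0 then 0 else c (i - 1)) * \<beta> ^ i) = \<beta> * (\<Sum>i<k. of_int (c i) * \<beta> ^ i)"
      unfolding k sum.lessThan_Suc_shift by (simp add: sum_distrib_left mult_ac)
    finally have eq: "\<beta> ^ Suc N - (\<Sum>i<r. of_int (c' i) * \<beta> ^ i) =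
      \<beta> * (\<beta> ^ N - (\<Sum>i<r. of_int (c i) * \<beta> ^ i)) + of_int (c k) * (\<beta> ^ r + (\<Sum>i<r. of_int (a i) * \<beta> ^ i))"
      by (simp add: k algebra_simps)
    have "v (\<beta> * (\<beta> ^ N - (\<Sum>i<r. of_int (c i) * \<beta> ^ i))) < 1" using c by (simp add: v_mult \<beta>)
    moreover have "v (of_int (c k) * (\<beta> ^ r + (\<Sum>i<r. of_int (a i) * \<beta> ^ i))) < 1"
      using rel v_of_int_le by (intro v_mult_less)
    ultimately have "v (\<beta> ^ Suc N - (\<Sum>i<r. of_int (c' i) * \<beta> ^ i)) < 1"
      unfolding eq by (rule v_add_less)
    thus ?case by blast
  qed
  then obtain c where c: "\<And>N. v (\<beta> ^ N - (\<Sum>i<r. of_int (c N i :: int) * \<beta> ^ i)) < 1" by metis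
  \<comment> \<open>Reducing the coefficients modulo \<open>p\<close> costs only an error of
    absolute value less than 1 and leaves finitely many tuples, so two powers share one.\<close>
  define C where "C N = (\<lambda>i \<in> {..<r}. c N i mod int p)" for N
  have C: "v (\<beta> ^ N - (\<Sum>i<r. of_int (C N i) * \<beta> ^ i)) < 1" for N
  proof -
    have "v (\<Sum>i<r. of_int (c N i - c N i mod int p) * \<beta> ^ i) < 1"
      by (intro v_sum_less small) auto
    moreover have "(\<Sum>i<r. of_int (c N i - c N i mod int p) * \<beta> ^ i) =
      (\<Sum>i<r. of_int (c N i) * \<beta> ^ i) - (\<Sum>i<r. of_int (C N i) * \<beta> ^ i)"
      unfolding sum_subtractf[symmetric]
      by (intro sum.cong refl) (simp add: C_def left_diff_distrib)
    ultimately have "v ((\<beta> ^ N - (\<Sum>i<r. of_int (c N i) * \<beta> ^ i)) +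
        ((\<Sum>i<r. of_int (c N i) * \<beta> ^ i) - (\<Sum>i<r. of_int (C N i) * \<beta> ^ i))) < 1"
      using c[of N] by (intro v_add_less) auto
    thus ?thesis by simp
  qed
  have "range C \<subseteq> PiE {..<r} (\<lambda>_. {0..<int p})"
    using p_gt_1 by (auto simp: C_def split: if_splits)
  hence "finite (range C)" by (rule finite_subset) (auto intro!: finite_PiE)
  hence "\<not> inj C" using finite_imageD infinite_UNIV_nat by blast
  then obtain N M where NM: "N < M" "C N = C M"
    unfolding inj_def by (metis linorder_neqE_nat)
  have "\<beta> ^ M - \<beta> ^ N = (\<beta> ^ M - (\<Sum>i<r. of_int (C M i) * \<beta> ^ i)) - (\<beta> ^ N - (\<Sum>i<r. of_int (C N i) * \<beta> ^ i))"
    using NM by simp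
  hence "v (\<beta> ^ M - \<beta> ^ N) < 1" using v_diff_less[OF C[of M] C[of N]] by simp
  moreover have "\<beta> ^ M - \<beta> ^ N = \<beta> ^ N * (\<beta> ^ (M - N) - 1)"
    using NM by (simp add: right_diff_distrib flip: power_add)
  ultimately have "v (\<beta> ^ (M - N) - 1) < 1" by (simp add: v_mult vpow)
  thus ?thesis using NM by (intro exI[of _ "M - N"]) simp
qed

text \<open>The three cases share one shape, with \<open>l\<close> and \<open>\<epsilon>\<close> of
  finite range, because estimates of this shape can be multiplied over all roots.\<close>

lemma v_power_minus_1_estimate:
  fixes J :: "int poly"
  assumes J: "J \<noteq> 0" "poly (map_poly of_int J) \<beta> = 0" and nr: "\<And>n. n > 0 \<Longrightarrow> \<beta> ^ n \<noteq> 1"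
  shows "\<exists>(l :: nat \<Rightarrow> nat) \<epsilon>. finite (range l) \<and> finite (\<epsilon> ` {1..}) \<and>
    (\<forall>n\<ge>1. v (\<beta> ^ n - 1) = max 1 (v \<beta>) ^ n * v (of_nat n) ^ l n * \<epsilon> n)"
proof -
  consider "v \<beta> < 1" | "v \<beta> > 1" | "v \<beta> = 1" by linarith
  thus ?thesis
  proof cases
    case 1
    have "v (\<beta> ^ n - 1) = 1" if "n \<ge> 1" for n
    proof -
      have "v (\<beta> ^ n) < 1" using 1 that v_nonneg[of \<beta>] by (simp add: v_power power_Suc_less_one power_less_one_iff)
      thus ?thesis using v_add_dominant[of "\<beta> ^ n" "- 1"] by (simp add: v_minus)
    qed
    moreover have "max 1 (v \<beta>) = 1" using 1 by simp
    ultimately show ?thesis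
      by (intro exI[of _ "\<lambda>_. 0"] exI[of _ "\<lambda>_. 1"]) (simp add: image_constant_conv)
  next
    case 2
    have "v (\<beta> ^ n - 1) = v \<beta> ^ n" if "n \<ge> 1" for n
    proof -
      have "v (\<beta> ^ n) > 1" using 2 that by (simp add: v_power one_less_power)
      thus ?thesis using v_add_dominant[of "- 1" "\<beta> ^ n"] by (simp add: v_minus v_power)
    qed
    moreover have "max 1 (v \<beta>) = v \<beta>" using 2 by simp
    ultimately show ?thesis
      by (intro exI[of _ "\<lambda>_. 0"] exI[of _ "\<lambda>_. 1"]) (simp add: image_constant_conv)
  next
    case 3
    define m where "m = (LEAST m. m > 0 \<and> v (\<beta> ^ m - 1) < 1)"
    have m: "m > 0" "v (\<beta> ^ m - 1) < 1"
      using LeastI_ex[OF unit_power_near_1[OF J 3]] by (auto simp: m_def)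
    \<comment> \<open>If \<open>\<beta> ^ n\<close> were close to 1, dividing by a power of
      \<open>\<beta> ^ m\<close> would make \<open>n mod m\<close> a smaller exponent with that
      property.\<close>
    have far: "v (\<beta> ^ n - 1) = 1" if "\<not> m dvd n" for n
    proof (rule ccontr)
      assume n: "v (\<beta> ^ n - 1) \<noteq> 1"
      have "v (\<beta> ^ n - 1) \<le> 1" using v_ultrametric[of "\<beta> ^ n" "- 1"] by (simp add: v_minus v_power 3)
      with n have n: "v (\<beta> ^ n - 1) < 1" by simp
      define q where "q = (\<beta> ^ m) ^ (n div m)"
      have "v (q - 1) < 1" using v_power_minus_1_le[of "\<beta> ^ m" "n div m"] m by (simp add: q_def)
      moreover have "\<beta> ^ n = q * \<beta> ^ (n mod m)"
        by (simp add: q_def flip: power_mult power_add)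
      hence "q * (\<beta> ^ (n mod m) - 1) = (\<beta> ^ n - 1) - (q - 1)" by (simp add: algebra_simps)
      ultimately have "v (q * (\<beta> ^ (n mod m) - 1)) < 1" using v_diff_less[OF n, of "q - 1"] by simp
      hence "v (\<beta> ^ (n mod m) - 1) < 1" by (simp add: v_mult q_def v_power 3)
      moreover have "n mod m > 0" using that by (simp add: mod_greater_zero_iff_not_dvd)
      ultimately have "m \<le> n mod m" unfolding m_def by (intro Least_le) simp
      thus False using mod_less_divisor[OF m(1), of n] by linarith
    qed
    define E where "E = (\<lambda>k. v ((\<beta> ^ m) ^ k - 1) / v (of_nat k)) ` {1..}"
    have finE: "finite E"
      unfolding E_def using m nr by (intro one_unit_power) (auto simp flip: power_mult)
    \<comment> \<open>For \<open>n = m * k\<close> this is the quotient of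
      \<open>one_unit_power\<close> for \<open>\<beta> ^ m\<close> at \<open>k\<close>, divided by
      the constant \<open>v (of_nat m)\<close>.\<close>
    define \<epsilon> where "\<epsilon> n = (if m dvd n then v (\<beta> ^ n - 1) / v (of_nat n) else 1)" for n
    have "\<epsilon> ` {1..} \<subseteq> insert 1 ((\<lambda>x. x / v (of_nat m)) ` E)"
    proof
      fix x assume "x \<in> \<epsilon> ` {1..}"
      then obtain n where n: "n \<ge> 1" "x = \<epsilon> n" by auto
      show "x \<in> insert 1 ((\<lambda>x. x / v (of_nat m)) ` E)"
      proof (cases "m dvd n")
        case True
        then obtain k where k: "n = m * k" by blast
        have "k \<ge> 1" using k n by (cases k) auto
        hence "v ((\<beta> ^ m) ^ k - 1) / v (of_nat k) \<in> E" by (auto simp: E_def)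
        moreover have "x = v ((\<beta> ^ m) ^ k - 1) / v (of_nat k) / v (of_nat m)"
          using n(2) unfolding \<epsilon>_def k
          by (simp add: v_mult power_mult mult.commute[of "v (of_nat m)"])
        ultimately show ?thesis by blast
      qed (use n in \<open>auto simp: \<epsilon>_def\<close>)
    qed
    hence "finite (\<epsilon> ` {1..})" using finE finite_subset by blast
    moreover have "v (\<beta> ^ n - 1) = max 1 (v \<beta>) ^ n * v (of_nat n) ^ (if m dvd n then 1 else 0) * \<epsilon> n"
      if "n \<ge> 1" for n
      using far[of n] that v_eq_0_iff[of "of_nat n"] by (simp add: \<epsilon>_def 3)
    moreover have "finite (range (\<lambda>n. if m dvd n then 1 else 0 :: nat))"
      by (rule finite_subset[of _ "{0, 1}"]) auto
    ultimately show ?thesis by blast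
  qed
qed

end

section \<open>Growth of the number of spanning trees\<close>

lemma poly_of_int_mult:
  "poly (map_poly of_int (f * g)) (z :: 'a :: field_char_0) = poly (map_poly of_int f) z * poly (map_poly of_int g) z"
proof (induction f)
  case (pCons a f)
  have *: "map_poly of_int (Polynomial.smult a g + h) =
      Polynomial.smult (of_int a) (map_poly of_int g) + (map_poly of_int h :: 'a poly)" for h
    by (rule poly_eqI) (simp add: coeff_map_poly)
  show ?case using pCons.IH by (simp add: map_poly_pCons * distrib_right mult.assoc)
qed simp

lemma poly_of_int_power:
  "poly (map_poly of_int (f ^ n)) (z :: 'a :: field_char_0) = poly (map_poly of_int f) z ^ n"
  by (induction n) (auto simp: poly_of_int_mult)

lemma laurent_shift_factor:
  "laurent_shift f = [:- 1, 1:] ^ laurent_ord1 f * (laurent_shift f div [:- 1, 1:] ^ laurent_ord1 f)"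
  using order_1[of 1 "laurent_shift f"] by (simp add: laurent_ord1_def)

lemma laurent_shift_quotient_nonzero:
  assumes "laurent_shift f \<noteq> 0"
  shows "poly (laurent_shift f div [:- 1, 1:] ^ laurent_ord1 f) 1 \<noteq> 0"
proof
  assume "poly (laurent_shift f div [:- 1, 1:] ^ laurent_ord1 f) 1 = 0"
  then obtain q where "laurent_shift f div [:- 1, 1:] ^ laurent_ord1 f = [:- 1, 1:] * q"
    by (auto simp: poly_eq_0_iff_dvd)
  hence "laurent_shift f = [:- 1, 1:] ^ Suc (laurent_ord1 f) * q"
    by (metis laurent_shift_factor power_Suc mult.assoc mult.commute)
  hence "[:- 1, 1:] ^ Suc (laurent_ord1 f) dvd laurent_shift f" by (rule dvdI)
  thus False using order_2[OF assms, of 1] by (simp only: laurent_ord1_def)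
qed

section \<open>Roots of unity and the Mahler measure in the p-adic field\<close>

context padic_complex_field
begin

text \<open>The polynomial with these roots splits because it is rational, and its roots are simple
  because its derivative vanishes only at 0.\<close>

lemma roots_of_unity:
  assumes n: "n > 0"
  defines "\<Omega> \<equiv> {z :: 'k. z ^ n = 1}"
  shows "finite \<Omega>" "card \<Omega> = n" "(\<Prod>z \<in> \<Omega>. x - z) = x ^ n - 1" "(\<Prod>z \<in> \<Omega> - {1}. 1 - z) = of_nat n"
proof -
  define f :: "'k poly" where "f = monom 1 n - 1"
  have coeff: "coeff f i = (if i = n then 1 else 0) - (if i = 0 then 1 else 0)" for i
    by (simp add: f_def)
  have deg: "degree f = n"
    using n by (intro antisym degree_le le_degree) (auto simp: coeff)
  have lead: "lead_coeff f = 1" using n by (simp add: deg coeff)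
  hence f0: "f \<noteq> 0" by auto
  have poly: "poly f z = z ^ n - 1" for z by (simp add: f_def poly_monom)
  have set: "set_mset (proots f) = \<Omega>" using f0 by (auto simp: poly \<Omega>_def)
  have "coeff f i \<in> \<rat>" for i by (simp add: coeff)
  hence split: "f = (\<Prod>\<beta> \<in># proots f. [:- \<beta>, 1:])"
    using rational_poly_splits[OF f0] lead by simp
  have simple: "Polynomial.order z f = 1" if "z \<in> \<Omega>" for z
  proof -
    have "poly (pderiv f) z = of_nat n * z ^ (n - 1)"
      by (simp add: f_def pderiv_diff pderiv_monom poly_monom)
    moreover have "z \<noteq> 0" using that n by (auto simp: \<Omega>_def power_0_left)
    ultimately have "poly (pderiv f) z \<noteq> 0" using n by simp
    hence "Polynomial.order z (pderiv f) = 0" by (rule order_0I)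
    moreover have "pderiv f \<noteq> 0" using \<open>poly (pderiv f) z \<noteq> 0\<close> by auto
    moreover have root: "poly f z = 0" using that by (simp add: poly \<Omega>_def)
    hence "Polynomial.order z f \<noteq> 0" using f0 order_root[of f z] by simp
    ultimately show ?thesis using order_pderiv[of f z] f0 root by simp
  qed
  have mset: "proots f = mset_set \<Omega>"
  proof (rule multiset_eqI)
    fix z
    have "finite \<Omega>" unfolding set[symmetric] by simp
    thus "count (proots f) z = count (mset_set \<Omega>) z"
      using simple[of z] f0 by (cases "z \<in> \<Omega>") (auto simp: order_root poly \<Omega>_def order_0I)
  qed
  show fin: "finite \<Omega>" unfolding set[symmetric] by simp
  have split': "f = (\<Prod>z \<in> \<Omega>. [:- z, 1:])"
    using split unfolding mset prod_unfold_prod_mset .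
  have "degree (\<Prod>z \<in> \<Omega>. [:- z, 1:]) = card \<Omega>"
    by (subst degree_prod_eq_sum_degree) auto
  thus "card \<Omega> = n" using split' deg by simp
  show "(\<Prod>z \<in> \<Omega>. x - z) = x ^ n - 1"
    using poly[of x] arg_cong[OF split', of "\<lambda>q. poly q x"] by (simp add: poly_prod)
  \<comment> \<open>Cancelling the factor at 1 leaves the geometric sum, whose value at 1 is
    \<open>n\<close>.\<close>
  have "f = [:- 1, 1:] * (\<Sum>i<n. monom 1 i)"
  proof -
    have "f = monom 1 1 ^ n - 1" by (simp add: f_def monom_power)
    also have "\<dots> = (monom 1 1 - 1) * (\<Sum>i<n. monom 1 1 ^ i)" by (rule power_diff_1_eq)
    also have "monom 1 1 - 1 = [:- 1, 1 :: 'k:]"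
      by (simp add: monom_altdef one_pCons)
    finally show ?thesis by (simp add: monom_power)
  qed
  moreover have "f = [:- 1, 1:] * (\<Prod>z \<in> \<Omega> - {1}. [:- z, 1:])"
    using prod.remove[OF fin, of 1 "\<lambda>z. [:- z, 1:]"] split' by (simp add: \<Omega>_def)
  ultimately have "(\<Prod>z \<in> \<Omega> - {1}. [:- z, 1:]) = (\<Sum>i<n. monom (1 :: 'k) i)"
    by (metis mult_left_cancel one_neq_zero pCons_eq_0_iff)
  from arg_cong[OF this, of "\<lambda>q. poly q 1"] show "(\<Prod>z \<in> \<Omega> - {1}. 1 - z) = of_nat n"
    by (simp add: poly_prod poly_sum poly_monom)
qed

lemma v_root_of_unity:
  assumes "n > 0" "z ^ n = 1"
  shows "v z = 1"
proof -
  have "v z ^ n = 1 ^ n" using assms(2) v_power[of z n] by simp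
  thus ?thesis using assms(1) v_nonneg by (metis power_eq_imp_eq_base zero_le_one)
qed

lemma v_power_int: "z \<noteq> 0 \<Longrightarrow> v z = 1 \<Longrightarrow> v (z powi k) = 1"
proof -
  assume z: "z \<noteq> 0" "v z = 1"
  have "v (inverse z) = 1"
    using v_mult[of z "inverse z"] z by simp
  thus ?thesis using z by (simp add: power_int_def v_power)
qed

lemma v_prod_power_minus_1_estimate:
  assumes "\<And>\<beta>. \<beta> \<in># R \<Longrightarrow> \<exists>(l :: nat \<Rightarrow> nat) \<epsilon>. finite (range l) \<and> finite (\<epsilon> ` {1..}) \<and>
    (\<forall>n\<ge>1. v (\<beta> ^ n - 1) = max 1 (v \<beta>) ^ n * v (of_nat n) ^ l n * \<epsilon> n)"
  shows "\<exists>(l :: nat \<Rightarrow> nat) \<epsilon>. finite (range l) \<and> finite (\<epsilon> ` {1..}) \<and>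
    (\<forall>n\<ge>1. (\<Prod>\<beta> \<in># R. v (\<beta> ^ n - 1)) = (\<Prod>\<beta> \<in># R. max 1 (v \<beta>)) ^ n * v (of_nat n) ^ l n * \<epsilon> n)"
  using assms
proof (induction R)
  case empty
  show ?case by (intro exI[of _ "\<lambda>_. 0"] exI[of _ "\<lambda>_. 1"]) (simp add: image_constant_conv)
next
  case (add \<beta> R)
  obtain l :: "nat \<Rightarrow> nat" and \<epsilon> where 1: "finite (range l)" "finite (\<epsilon> ` {1..})"
    "\<And>n. n \<ge> 1 \<Longrightarrow> (\<Prod>\<beta> \<in># R. v (\<beta> ^ n - 1)) = (\<Prod>\<beta> \<in># R. max 1 (v \<beta>)) ^ n * v (of_nat n) ^ l n * \<epsilon> n"
    using add.IH add.prems by (metis union_iff add_mset_add_single)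
  obtain l' :: "nat \<Rightarrow> nat" and \<epsilon>' where 2: "finite (range l')" "finite (\<epsilon>' ` {1..})"
    "\<And>n. n \<ge> 1 \<Longrightarrow> v (\<beta> ^ n - 1) = max 1 (v \<beta>) ^ n * v (of_nat n) ^ l' n * \<epsilon>' n"
    using add.prems[of \<beta>] by auto
  have "range (\<lambda>n. l' n + l n) \<subseteq> (\<lambda>(x, y). x + y) ` (range l' \<times> range l)" by auto
  hence "finite (range (\<lambda>n. l' n + l n))"
    using 1(1) 2(1) by (meson finite_SigmaI finite_imageI finite_subset)
  moreover have "(\<lambda>n. \<epsilon>' n * \<epsilon> n) ` {1..} \<subseteq> (\<lambda>(x, y). x * y) ` ((\<epsilon>' ` {1..}) \<times> (\<epsilon> ` {1..}))" by auto
  hence "finite ((\<lambda>n. \<epsilon>' n * \<epsilon> n) ` {1..})"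
    using 1(2) 2(2) by (meson finite_SigmaI finite_imageI finite_subset)
  moreover have "(\<Prod>\<beta> \<in># add_mset \<beta> R. v (\<beta> ^ n - 1)) =
      (\<Prod>\<beta> \<in># add_mset \<beta> R. max 1 (v \<beta>)) ^ n * v (of_nat n) ^ (l' n + l n) * (\<epsilon>' n * \<epsilon> n)" if "n \<ge> 1" for n
    using 1(3)[OF that] 2(3)[OF that] by (simp add: power_add power_mult_distrib)
  ultimately show ?case by blast
qed

lemma padic_mahler_power:
  fixes J :: "int poly"
  assumes J: "J \<noteq> 0"
  obtains k where "padic_mahler v (map_poly of_int J) = (1 / real p) ^ k"
proof -
  let ?J = "map_poly of_int J :: 'k poly"
  let ?P = "\<Prod>\<beta> \<in># proots ?J. [:- \<beta>, 1:]"
  have J0: "?J \<noteq> 0" using J by (simp add: map_poly_eq_0_iff)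
  have "coeff ?J i \<in> \<rat>" for i by (simp add: coeff_map_poly)
  hence split: "?J = Polynomial.smult (lead_coeff ?J) ?P" by (rule rational_poly_splits[OF J0])
  \<comment> \<open>Scaled by the leading coefficient, the largest coefficient of the monic factor
    becomes an integer coefficient of \<open>J\<close>, so the measure is the absolute value of an
    integer.\<close>
  obtain i where "v (coeff ?P i) = (\<Prod>\<beta> \<in># proots ?J. max 1 (v \<beta>))"
    using gauss_norm[of "proots ?J"] by blast
  moreover have "coeff ?J i = lead_coeff ?J * coeff ?P i"
    using arg_cong[OF split, of "\<lambda>q. coeff q i"] by simp
  ultimately have M: "padic_mahler v ?J = v (of_int (coeff J i))"
    by (simp add: padic_mahler_def v_mult coeff_map_poly)
  have "v (lead_coeff ?J) > 0" using J0 by (intro v_pos) simp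
  moreover have "(\<Prod>\<beta> \<in># R. max 1 (v \<beta>)) > 0" for R
    by (induction R) (auto simp: less_max_iff_disj)
  ultimately have "padic_mahler v ?J > 0" by (simp add: padic_mahler_def)
  hence "coeff J i \<noteq> 0" using M by auto
  thus thesis using v_of_int_power M that by metis
qed

end

theorem theorem1p1:
  fixes X :: "('v, 'e) pre_digraph" and bar :: "'e \<Rightarrow> 'e"
    and \<alpha> :: "'e \<Rightarrow> int" and vs :: "'v list"
    and p :: nat and v :: "'k::field_char_0 \<Rightarrow> real"
  assumes "bidirected_digraph X bar"
    and "finite (verts X)" and "finite (arcs X)"
    and "strongly_connected X"
    and "euler_char X \<noteq> 0"
    and "voltage_assignment X bar integer_group \<alpha>"
    and "\<And>n. n \<ge> 1 \<Longrightarrow> strongly_connected (cyclic_cover X \<alpha> n)"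
    and "distinct vs" and "set vs = verts X"
    and "prime p"
    and "padic_complex_field p v"
  shows "\<exists>(lam :: nat \<Rightarrow> nat) (nu :: nat \<Rightarrow> int) (c :: int).
           finite (lam ` {1..}) \<and> finite (nu ` {1..}) \<and>
           (\<forall>n\<ge>1. real (multiplicity p (kappa (cyclic_cover X \<alpha> n) (cyclic_cover_bar X bar \<alpha> n))) =
             mu_invariant p v X \<alpha> vs * real n + real (lam n) * real (multiplicity p n)
               + of_int (nu n) + of_int c)"
proof -
  interpret padic_complex_field p v by fact
  define \<kappa> where "\<kappa> n = kappa (cyclic_cover X \<alpha> n) (cyclic_cover_bar X bar \<alpha> n)" for n
  define I where "I = ihara_poly X \<alpha> vs"
  define J where "J = J_poly X \<alpha> vs"
  define e where "e = laurent_ord1 I"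
  define Jk where "Jk = (map_poly of_int J :: 'k poly)"
  define \<Omega> where "\<Omega> n = {z :: 'k. z ^ n = 1}" for n
  have ne: "verts X \<noteq> {}" using assms(4) by (simp add: strongly_connected_def)
  have \<kappa>_pos: "\<kappa> n > 0" if "n \<ge> 1" for n
  proof -
    interpret Y: bidirected_digraph "cyclic_cover X \<alpha> n" "cyclic_cover_bar X bar \<alpha> n"
      by (rule bidirected_cyclic_cover) (use assms that in auto)
    show ?thesis unfolding \<kappa>_def
      by (rule Y.kappa_pos[OF _ _ assms(7)[OF that]]) (use assms(2,3) that in \<open>simp_all add: cyclic_cover_simps\<close>)
  qed
  have prod: "of_nat (n * \<kappa> n) = of_nat (\<kappa> 1) * (\<Prod>z \<in> \<Omega> n - {1}. leval z I)" if "n \<ge> 1" for n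
    unfolding \<kappa>_def I_def \<Omega>_def
    using that roots_of_unity(2)[of n] by (intro kappa_cyclic_cover(1) assms ne) auto
  have leval_1: "leval (1 :: 'k) I = 0"
    unfolding I_def using roots_of_unity(2)[of 1]
    by (intro kappa_cyclic_cover(2)[where n = 1, OF assms(1,3) ne assms(6,8,9)]) auto
  have \<Omega>: "finite (\<Omega> n)" "card (\<Omega> n) = n" if "n \<ge> 1" for n
    using roots_of_unity[of n] that by (auto simp: \<Omega>_def)
  have \<Omega>_nz: "z \<noteq> 0" if "z \<in> \<Omega> n" "n \<ge> 1" for z n
    using that by (auto simp: \<Omega>_def power_0_left)
  \<comment> \<open>A zero would make the product formula read
    \<open>n * \<kappa> n = 0\<close>.\<close>
  have leval_nz: "leval z I \<noteq> 0" if "n \<ge> 1" "z \<in> \<Omega> n" "z \<noteq> 1" for n z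
  proof
    assume "leval z I = 0"
    hence "(\<Prod>z \<in> \<Omega> n - {1}. leval z I) = 0" using that \<Omega>(1)[OF that(1)] by (auto simp: prod_zero_iff)
    thus False using prod[OF that(1)] \<kappa>_pos[OF that(1)] that(1) by (simp del: of_nat_mult)
  qed
  have leval: "leval z I = z powi laurent_ord0 I * ((z - 1) ^ e * poly Jk z)" if "z \<noteq> 0" for z :: 'k
  proof -
    have "laurent_shift I = [:- 1, 1:] ^ e * J"
      using laurent_shift_factor[of I] by (simp add: e_def J_def J_poly_def I_def)
    thus ?thesis
      unfolding leval_shift[OF that] Jk_def
      by (simp add: poly_of_int_mult poly_of_int_power map_poly_pCons)
  qed
  \<comment> \<open>The point -1 is a test: it is a square root of unity other than 1, so the double
    cover already shows that \<open>I\<close> is not 0.\<close>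
  have shift: "laurent_shift I \<noteq> 0"
  proof
    assume "laurent_shift I = 0"
    hence "leval (- 1 :: 'k) I = 0" by (simp add: leval_shift)
    moreover have "- 1 \<in> \<Omega> 2" by (simp add: \<Omega>_def)
    ultimately show False using leval_nz[of 2 "- 1"] by simp
  qed
  \<comment> \<open>Needed to cancel the factor \<open>n\<close> beside \<open>\<kappa> n\<close>
    against one of the \<open>e\<close> factors \<open>v (of_nat n)\<close>.\<close>
  have "e \<ge> 1"
  proof -
    have "poly (map_poly of_int (laurent_shift I)) (1 :: 'k) = 0"
      using leval_1 by (simp add: leval_shift)
    moreover have "poly (map_poly of_int f) (1 :: 'k) = of_int (poly f 1)" for f
      by (induction f) (auto simp: map_poly_pCons)
    ultimately have "poly (laurent_shift I) 1 = 0" by simp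
    thus ?thesis using shift by (simp add: e_def laurent_ord1_def order_root Suc_le_eq)
  qed
  have J1: "poly Jk 1 \<noteq> 0"
  proof -
    have "poly J 1 \<noteq> 0"
      using laurent_shift_quotient_nonzero[OF shift] by (simp add: J_def J_poly_def I_def)
    moreover have "poly (map_poly of_int f) (1 :: 'k) = of_int (poly f 1)" for f
      by (induction f) (auto simp: map_poly_pCons)
    ultimately show ?thesis by (simp add: Jk_def)
  qed
  hence J0: "J \<noteq> 0" "Jk \<noteq> 0" by (auto simp: Jk_def)
  define R where "R = proots Jk"
  have "coeff Jk i \<in> \<rat>" for i by (simp add: Jk_def coeff_map_poly)
  hence split: "Jk = Polynomial.smult (lead_coeff Jk) (\<Prod>\<beta> \<in># R. [:- \<beta>, 1:])"
    unfolding R_def by (rule rational_poly_splits[OF J0(2)])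
  have Jk_eval: "v (poly Jk z) = v (lead_coeff Jk) * (\<Prod>\<beta> \<in># R. v (\<beta> - z))" for z
    using arg_cong[OF split, of "\<lambda>q. v (poly q z)"]
    by (simp add: v_mult poly_prod_mset v_prod_mset v_diff_commute[of z])
  have "\<exists>(l :: nat \<Rightarrow> nat) \<epsilon>. finite (range l) \<and> finite (\<epsilon> ` {1..}) \<and>
    (\<forall>n\<ge>1. (\<Prod>\<beta> \<in># R. v (\<beta> ^ n - 1)) = (\<Prod>\<beta> \<in># R. max 1 (v \<beta>)) ^ n * v (of_nat n) ^ l n * \<epsilon> n)"
  proof (rule v_prod_power_minus_1_estimate, rule v_power_minus_1_estimate[OF J0(1)])
    fix \<beta> assume "\<beta> \<in># R"
    hence root: "poly Jk \<beta> = 0" using J0 by (simp add: R_def)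
    thus "poly (map_poly of_int J) \<beta> = 0" by (simp add: Jk_def)
    show "\<beta> ^ n \<noteq> 1" if "n > 0" for n
    proof
      assume "\<beta> ^ n = 1"
      hence "\<beta> \<in> \<Omega> n" by (simp add: \<Omega>_def)
      moreover have "\<beta> \<noteq> 1" using root J1 by auto
      moreover have "leval \<beta> I = 0" using leval[of \<beta>] \<Omega>_nz[OF \<open>\<beta> \<in> \<Omega> n\<close>] that root by simp
      ultimately show False using leval_nz[of n \<beta>] that by simp
    qed
  qed
  then obtain l :: "nat \<Rightarrow> nat" and \<epsilon> where l: "finite (range l)" "finite (\<epsilon> ` {1..})"
    "\<And>n. n \<ge> 1 \<Longrightarrow> (\<Prod>\<beta> \<in># R. v (\<beta> ^ n - 1)) = (\<Prod>\<beta> \<in># R. max 1 (v \<beta>)) ^ n * v (of_nat n) ^ l n * \<epsilon> n"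
    by blast
  define M where "M = padic_mahler v Jk"
  obtain k where k: "M = (1 / real p) ^ k"
    using padic_mahler_power[OF J0(1)] unfolding M_def Jk_def by blast
  have mu: "mu_invariant p v X \<alpha> vs = real k"
    using p_gt_1 k by (simp add: mu_invariant_def log_padic_mahler_def M_def Jk_def J_def ln_realpow ln_div)
  \<comment> \<open>The product formula omits z = 1, while the product of \<open>J\<close> over all
    roots of unity contains it; hence the division by the value at 1.\<close>
  define A where "A = v (of_nat (\<kappa> 1)) / v (poly Jk 1)"
  have key: "v (of_nat (\<kappa> n)) = A * \<epsilon> n * M ^ n * v (of_nat n) ^ (e - 1 + l n)" if n: "n \<ge> 1" for n
  proof -
    have vn: "v (of_nat n) \<noteq> 0" using n v_eq_0_iff[of "of_nat n"] by simp
    have one: "1 \<in> \<Omega> n" by (simp add: \<Omega>_def)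
    have "(\<Prod>z \<in> \<Omega> n - {1}. v (z - 1)) = v (of_nat n)"
    proof -
      have "(\<Prod>z \<in> \<Omega> n - {1}. v (z - 1)) = v (\<Prod>z \<in> \<Omega> n - {1}. 1 - z)"
        by (simp add: v_prod v_diff_commute[of 1])
      thus ?thesis using roots_of_unity(4)[of n] n by (simp add: \<Omega>_def)
    qed
    moreover have "v (leval z I) = v (z - 1) ^ e * v (poly Jk z)" if "z \<in> \<Omega> n - {1}" for z
      using that n leval[of z] \<Omega>_nz[of z n] v_root_of_unity[of n z]
      by (simp add: v_mult v_power v_power_int \<Omega>_def)
    ultimately have "(\<Prod>z \<in> \<Omega> n - {1}. v (leval z I)) = v (of_nat n) ^ e * (\<Prod>z \<in> \<Omega> n - {1}. v (poly Jk z))"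
      by (simp add: prod.distrib flip: prod_power_distrib)
    moreover have "(\<Prod>z \<in> \<Omega> n. v (poly Jk z)) = v (poly Jk 1) * (\<Prod>z \<in> \<Omega> n - {1}. v (poly Jk z))"
      using \<Omega>(1)[OF n] one by (rule prod.remove)
    moreover have "(\<Prod>z \<in> \<Omega> n. v (poly Jk z)) = M ^ n * v (of_nat n) ^ l n * \<epsilon> n"
    proof -
      have "(\<Prod>z \<in> \<Omega> n. v (poly Jk z)) = v (lead_coeff Jk) ^ n * (\<Prod>z \<in> \<Omega> n. \<Prod>\<beta> \<in># R. v (\<beta> - z))"
        using \<Omega>[OF n] by (simp add: Jk_eval prod.distrib)
      \<comment> \<open>The resultant of \<open>J\<close> and the polynomial of the
        \<open>n\<close>-th roots of unity, computed from either side: values of \<open>J\<close> at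
        roots of unity become values of that polynomial at the roots of \<open>J\<close>.\<close>
      also have "(\<Prod>z \<in> \<Omega> n. \<Prod>\<beta> \<in># R. v (\<beta> - z)) = (\<Prod>\<beta> \<in># R. \<Prod>z \<in> \<Omega> n. v (\<beta> - z))"
        unfolding prod_unfold_prod_mset by (rule prod_mset.swap)
      also have "\<dots> = (\<Prod>\<beta> \<in># R. v (\<beta> ^ n - 1))"
        using roots_of_unity(3)[of n] n by (simp add: \<Omega>_def flip: v_prod)
      also have "\<dots> = (\<Prod>\<beta> \<in># R. max 1 (v \<beta>)) ^ n * v (of_nat n) ^ l n * \<epsilon> n"
        by (rule l(3)[OF n])
      finally show ?thesis by (simp add: M_def padic_mahler_def R_def power_mult_distrib)
    qed
    moreover have "v (of_nat n) * v (of_nat (\<kappa> n)) = v (of_nat (\<kappa> 1)) * (\<Prod>z \<in> \<Omega> n - {1}. v (leval z I))"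
      using arg_cong[OF prod[OF n], of v] by (simp add: v_mult v_prod)
    moreover have "v (poly Jk 1) \<noteq> 0" using J1 v_eq_0_iff by simp
    ultimately have "v (of_nat n) * v (of_nat (\<kappa> n)) = v (of_nat n) ^ e * (A * \<epsilon> n * M ^ n * v (of_nat n) ^ l n)"
      by (simp add: A_def field_simps)
    moreover have "v (of_nat n) ^ e = v (of_nat n) * v (of_nat n) ^ (e - 1)"
      using \<open>e \<ge> 1\<close> by (simp flip: power_Suc)
    ultimately have "v (of_nat n) * v (of_nat (\<kappa> n)) =
        v (of_nat n) * (A * \<epsilon> n * M ^ n * v (of_nat n) ^ (e - 1 + l n))"
      by (simp add: power_add mult_ac)
    thus ?thesis using vn by simp
  qed
  \<comment> \<open>One of the \<open>e\<close> factors has been spent on the \<open>n\<close> in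
    \<open>n * \<kappa> n\<close>.\<close>
  define lam where "lam n = e - 1 + l n" for n
  \<comment> \<open>The exact remainder, an integer because the slope is the integer
    \<open>k\<close>. The formula then holds by definition, and what remains is that
    \<open>nu n\<close> depends only on \<open>\<epsilon> n\<close>, which takes finitely many
    values.\<close>
  define nu where "nu n = int (multiplicity p (\<kappa> n)) - int k * int n - int (lam n) * int (multiplicity p n)" for n
  have "real_of_int (nu n) = - ln (A * \<epsilon> n) / ln (real p)" if n: "n \<ge> 1" for n
  proof -
    have "(1 / real p) ^ multiplicity p (\<kappa> n) =
        A * \<epsilon> n * ((1 / real p) ^ k) ^ n * ((1 / real p) ^ multiplicity p n) ^ lam n"
      using key[OF n] \<kappa>_pos[OF n] n by (simp add: v_of_nat k lam_def)
    hence eq: "(1 / real p) ^ multiplicity p (\<kappa> n) =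
        A * \<epsilon> n * (1 / real p) ^ (k * n + multiplicity p n * lam n)"
      by (simp add: power_add power_mult mult.assoc)
    have "A * \<epsilon> n > 0"
    proof -
      have "0 < A * \<epsilon> n * (1 / real p) ^ (k * n + multiplicity p n * lam n)"
        unfolding eq[symmetric] using p_gt_1 by simp
      thus ?thesis using p_gt_1 by (simp add: zero_less_mult_iff)
    qed
    hence "ln ((1 / real p) ^ multiplicity p (\<kappa> n)) =
        ln (A * \<epsilon> n) + ln ((1 / real p) ^ (k * n + multiplicity p n * lam n))"
      unfolding eq using p_gt_1 by (intro ln_mult_pos) auto
    hence "- real (multiplicity p (\<kappa> n)) * ln (real p) =
        ln (A * \<epsilon> n) - real (k * n + multiplicity p n * lam n) * ln (real p)"
      using p_gt_1 by (simp add: ln_realpow ln_div)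
    hence "- ln (A * \<epsilon> n) = real_of_int (nu n) * ln (real p)"
      by (simp add: nu_def algebra_simps)
    thus ?thesis using p_gt_1 by simp
  qed
  hence "real_of_int ` nu ` {1..} \<subseteq> (\<lambda>x. - ln (A * x) / ln (real p)) ` \<epsilon> ` {1..}" by auto
  hence "finite (real_of_int ` nu ` {1..})" using l(2) finite_subset by blast
  hence fin_nu: "finite (nu ` {1..})" by (rule finite_imageD) (simp add: inj_on_def)
  have "lam ` {1..} \<subseteq> (\<lambda>x. e - 1 + x) ` range l" by (auto simp: lam_def)
  hence fin_lam: "finite (lam ` {1..})" using l(1) finite_subset by blast
  have "real (multiplicity p (\<kappa> n)) = mu_invariant p v X \<alpha> vs * real n +
      real (lam n) * real (multiplicity p n) + of_int (nu n) + of_int 0" for n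
    by (simp add: mu nu_def)
  thus ?thesis using fin_lam fin_nu unfolding \<kappa>_def by blast
qed

end
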